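(* Let $\Lambda_{\mathcal{O}}^{cbn} = (\Lambda_{\mathcal{O}}, \to_\beta\cup\to_{\mathcal{O}})$ and $\Lambda_{\mathcal{O}}^{cbv} = (\Lambda_{\mathcal{O}}, \to_{\beta_v}\cup\to_{\mathcal{O}})$, and let $\Lambda_{!\mathcal{O}}$ denote the bang calculus $(\Lambda_{!\mathcal{O}}, \to_{!\beta}\cup\to_{\mathcal{O}})$. (1) If $\Lambda_{!\mathcal{O}}$ admits least-level factorization, i.e. $\to^*\subseteq\to_{\ell\ell}^*\cdot\to_{\neg\ell\ell}^*$, then so do $\Lambda_{\mathcal{O}}^{cbn}$ and $\Lambda_{\mathcal{O}}^{cbv}$. (2) If $\Lambda_{!\mathcal{O}}$ admits least-level normalization (i.e. $\to_{\ell\ell}$ is a normalizing strategy for $\to$), then so do $\Lambda_{\mathcal{O}}^{cbn}$ and $\Lambda_{\mathcal{O}}^{cbv}$.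
   Context: Fix operators $\mathcal{O}$ with arities. $\lambda$-terms $t ::= x\mid\lambda x.t\mid ts\mid\mathbf{o}(t_1,\dots,t_k)$ (set $\Lambda_{\mathcal{O}}$; values = variables and abstractions); bang terms $T ::= x\mid\lambda x.T\mid TS\mid !T\mid\mathbf{o}(T_1,\dots,T_k)$ (set $\Lambda_{!\mathcal{O}}$). $\to_\rho$ is the closure of a rule $\mapsto_\rho$ under one-hole contexts. Rules: $(\lambda x.t)s\mapsto_\beta t[s/x]$, $(\lambda x.t)v\mapsto_{\beta_v}t[v/x]$ ($v$ value), $(\lambda x.T)\,!S\mapsto_{!\beta}T[S/x]$; for each $\mathbf{o}\in\mathcal{O}$ a rule $\mapsto_{\mathbf{o}}$ with left-hand sides $\mathbf{o}(\dots)$, $\to_{\mathcal{O}}=\bigcup_{\mathbf{o}}\to_{\mathbf{o}}$. The bang rules $\mapsto_{\mathbf{o}}$ are the images of the $\lambda$-rules under the CbN translation ($x^n=x$, $(\lambda x.t)^n=\lambda x.t^n$, $\mathbf{o}(t_1,\dots)^n=\mathbf{o}(t_1^n,\dots)$, $(ts)^n=t^n\,!(s^n)$) when transferring to $\Lambda^{cbn}_{\mathcal{O}}$, and under the CbV translation ($x^v=!x$, $(\lambda x.t)^v=!(\lambda x.t^v)$, $\mathbf{o}(t_1,\dots)^v=\mathbf{o}(t_1^v,\dots)$, $(ts)^v=T\,s^v$ if $t^v=!T$, else $((\lambda x.x)\,t^v)\,s^v$) when transferring to $\Lambda^{cbv}_{\mathcal{O}}$. Levels of one-hole contexts: bang: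 $0$ at hole, $+1$ under $!$ and under operators, unchanged under $\lambda$ and application; CbN: $0$ at hole, unchanged under $\lambda x.c$ and $ct$, $+1$ under $tc$ and operators; CbV: $0$ at hole, $+1$ under $\lambda x.c$, level of $ct$ is that of $c'$ if $c=\lambda x.c'$ and of $c$ otherwise, unchanged under $tc$, $+1$ under operators. In each calculus, with $\mathcal{R}$ the set of all redexes of its reduction $\to$, the least level of a term $T$ is $\inf\{\text{level of }C \mid T=C[R], R\in\mathcal{R}\}\in\mathbb{N}\cup\{\infty\}$; a step $C[R]\to C[R']$ is least-level ($\to_{\ell\ell}$) if the level of $C$ equals the least level of $C[R]$, internal ($\to_{\neg\ell\ell}$) if strictly greater. A strategy $\to_e\subseteq\to$ with the same normal forms as $\to$ is normalizing if, whenever $t\to^* u$ with $u$ $\to$-normal, every maximal $\to_e$-sequence from $t$ ends in a normal form.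
   Formalization: For the call-by-value half of (1), it is additionally assumed that reducing inside an argument of an operator redex leaves an operator redex (automatic if every o(t1,…,tk) is a redex); for arbitrary operator rules this half fails. *)

theory Defs
  imports Main "HOL-Library.Extended_Nat"
begin

section \<open>Reduction with levels\<close>

text \<open>
  A calculus consists of its set of terms, its one-hole contexts (the type \<open>'c\<close>) with their hole
  filling and their level, and its root rules. Filling may capture variables.
\<close>

record ('t, 'c) calculus =
  terms :: "'t set"
  fill :: "'c \<Rightarrow> 't \<Rightarrow> 't"
  level :: "'c \<Rightarrow> nat"
  root :: "('t \<times> 't) set"

definition red :: "('t, 'c) calculus \<Rightarrow> ('t \<times> 't) set" where
  "red K = {(fill K C R, fill K C R') | C R R'. (R, R') \<in> root K} \<inter> terms K \<times> terms K"

definition redexes :: "('t, 'c) calculus \<Rightarrow> 't set" where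
  "redexes K = Domain (root K)"

definition least_level :: "('t, 'c) calculus \<Rightarrow> 't \<Rightarrow> enat" where
  "least_level K T = Inf {enat (level K C) | C R. T = fill K C R \<and> R \<in> redexes K}"

definition ll_red :: "('t, 'c) calculus \<Rightarrow> ('t \<times> 't) set" where
  "ll_red K = {(fill K C R, fill K C R') | C R R'. (R, R') \<in> root K \<and>
     enat (level K C) = least_level K (fill K C R)} \<inter> terms K \<times> terms K"

definition internal_red :: "('t, 'c) calculus \<Rightarrow> ('t \<times> 't) set" where
  "internal_red K = {(fill K C R, fill K C R') | C R R'. (R, R') \<in> root K \<and>
     enat (level K C) > least_level K (fill K C R)} \<inter> terms K \<times> terms K"

definition normal :: "('t \<times> 't) set \<Rightarrow> 't \<Rightarrow> bool" where
  "normal r t \<longleftrightarrow> (\<nexists>s. (t, s) \<in> r)"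

text \<open>
  A maximal \<open>e\<close>-sequence from \<open>t\<close> is either infinite or ends in an \<open>e\<close>-normal term.
\<close>

definition maximal_seqs_end_in_nf :: "('t \<times> 't) set \<Rightarrow> ('t \<times> 't) set \<Rightarrow> 't \<Rightarrow> bool" where
  "maximal_seqs_end_in_nf e r t \<longleftrightarrow>
     (\<nexists>f :: nat \<Rightarrow> 't. f 0 = t \<and> (\<forall>i. (f i, f (Suc i)) \<in> e)) \<and>
     (\<forall>s. (t, s) \<in> e\<^sup>* \<and> normal e s \<longrightarrow> normal r s)"

definition normalizing_strategy :: "('t \<times> 't) set \<Rightarrow> ('t \<times> 't) set \<Rightarrow> bool" where
  "normalizing_strategy e r \<longleftrightarrow>
     e \<subseteq> r \<and> (\<forall>t. normal e t \<longleftrightarrow> normal r t) \<and>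
     (\<forall>t u. (t, u) \<in> r\<^sup>* \<and> normal r u \<longrightarrow> maximal_seqs_end_in_nf e r t)"

definition ll_factorization :: "('t, 'c) calculus \<Rightarrow> bool" where
  "ll_factorization K \<longleftrightarrow> (red K)\<^sup>* \<subseteq> (ll_red K)\<^sup>* O (internal_red K)\<^sup>*"

definition ll_normalization :: "('t, 'c) calculus \<Rightarrow> bool" where
  "ll_normalization K \<longleftrightarrow> normalizing_strategy (ll_red K) (red K)"


section \<open>Terms modulo alpha, as de Bruijn terms\<close>

datatype 'o lam = Var nat | Lam "'o lam" | App "'o lam" "'o lam" | Op 'o "'o lam list"

datatype 'o bang = BVar nat | BLam "'o bang" | BApp "'o bang" "'o bang" | Bang "'o bang"
  | BOp 'o "'o bang list"

inductive_set lam_terms :: "'o set \<Rightarrow> ('o \<Rightarrow> nat) \<Rightarrow> 'o lam set"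
  for Ops :: "'o set" and ar :: "'o \<Rightarrow> nat" where
  "Var i \<in> lam_terms Ops ar"
| "t \<in> lam_terms Ops ar \<Longrightarrow> Lam t \<in> lam_terms Ops ar"
| "t \<in> lam_terms Ops ar \<Longrightarrow> s \<in> lam_terms Ops ar \<Longrightarrow> App t s \<in> lam_terms Ops ar"
| "f \<in> Ops \<Longrightarrow> length ts = ar f \<Longrightarrow> \<forall>t \<in> set ts. t \<in> lam_terms Ops ar \<Longrightarrow>
     Op f ts \<in> lam_terms Ops ar"

inductive_set bang_terms :: "'o set \<Rightarrow> ('o \<Rightarrow> nat) \<Rightarrow> 'o bang set"
  for Ops :: "'o set" and ar :: "'o \<Rightarrow> nat" where
  "BVar i \<in> bang_terms Ops ar"
| "T \<in> bang_terms Ops ar \<Longrightarrow> BLam T \<in> bang_terms Ops ar"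
| "T \<in> bang_terms Ops ar \<Longrightarrow> S \<in> bang_terms Ops ar \<Longrightarrow> BApp T S \<in> bang_terms Ops ar"
| "T \<in> bang_terms Ops ar \<Longrightarrow> Bang T \<in> bang_terms Ops ar"
| "f \<in> Ops \<Longrightarrow> length Ts = ar f \<Longrightarrow> \<forall>T \<in> set Ts. T \<in> bang_terms Ops ar \<Longrightarrow>
     BOp f Ts \<in> bang_terms Ops ar"

primrec lift :: "'o lam \<Rightarrow> nat \<Rightarrow> 'o lam" where
  "lift (Var i) k = (if i < k then Var i else Var (Suc i))"
| "lift (Lam t) k = Lam (lift t (Suc k))"
| "lift (App t s) k = App (lift t k) (lift s k)"
| "lift (Op f ts) k = Op f (map (\<lambda>t. lift t k) ts)"

text \<open>\<open>subst t s k\<close> replaces index \<open>k\<close> by \<open>s\<close> and removes the binder of \<open>k\<close>.\<close>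

primrec subst :: "'o lam \<Rightarrow> 'o lam \<Rightarrow> nat \<Rightarrow> 'o lam" where
  "subst (Var i) s k = (if k < i then Var (i - 1) else if i = k then s else Var i)"
| "subst (Lam t) s k = Lam (subst t (lift s 0) (Suc k))"
| "subst (App t u) s k = App (subst t s k) (subst u s k)"
| "subst (Op f ts) s k = Op f (map (\<lambda>t. subst t s k) ts)"

primrec blift :: "'o bang \<Rightarrow> nat \<Rightarrow> 'o bang" where
  "blift (BVar i) k = (if i < k then BVar i else BVar (Suc i))"
| "blift (BLam T) k = BLam (blift T (Suc k))"
| "blift (BApp T S) k = BApp (blift T k) (blift S k)"
| "blift (Bang T) k = Bang (blift T k)"
| "blift (BOp f Ts) k = BOp f (map (\<lambda>T. blift T k) Ts)"

primrec bsubst :: "'o bang \<Rightarrow> 'o bang \<Rightarrow> nat \<Rightarrow> 'o bang" where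
  "bsubst (BVar i) S k = (if k < i then BVar (i - 1) else if i = k then S else BVar i)"
| "bsubst (BLam T) S k = BLam (bsubst T (blift S 0) (Suc k))"
| "bsubst (BApp T U) S k = BApp (bsubst T S k) (bsubst U S k)"
| "bsubst (Bang T) S k = Bang (bsubst T S k)"
| "bsubst (BOp f Ts) S k = BOp f (map (\<lambda>T. bsubst T S k) Ts)"


section \<open>Contexts and levels\<close>

datatype 'o lctx = LHole | LCLam "'o lctx" | LCAppL "'o lctx" "'o lam" | LCAppR "'o lam" "'o lctx"
  | LCOp 'o "'o lam list" "'o lctx" "'o lam list"

primrec lfill :: "'o lctx \<Rightarrow> 'o lam \<Rightarrow> 'o lam" where
  "lfill LHole r = r"
| "lfill (LCLam c) r = Lam (lfill c r)"
| "lfill (LCAppL c t) r = App (lfill c r) t"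
| "lfill (LCAppR t c) r = App t (lfill c r)"
| "lfill (LCOp f ts c us) r = Op f (ts @ lfill c r # us)"

datatype 'o bctx = BHole | BCLam "'o bctx" | BCAppL "'o bctx" "'o bang"
  | BCAppR "'o bang" "'o bctx" | BCBang "'o bctx"
  | BCOp 'o "'o bang list" "'o bctx" "'o bang list"

primrec bfill :: "'o bctx \<Rightarrow> 'o bang \<Rightarrow> 'o bang" where
  "bfill BHole R = R"
| "bfill (BCLam C) R = BLam (bfill C R)"
| "bfill (BCAppL C T) R = BApp (bfill C R) T"
| "bfill (BCAppR T C) R = BApp T (bfill C R)"
| "bfill (BCBang C) R = Bang (bfill C R)"
| "bfill (BCOp f Ts C Us) R = BOp f (Ts @ bfill C R # Us)"

primrec bang_level :: "'o bctx \<Rightarrow> nat" where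
  "bang_level BHole = 0"
| "bang_level (BCLam C) = bang_level C"
| "bang_level (BCAppL C T) = bang_level C"
| "bang_level (BCAppR T C) = bang_level C"
| "bang_level (BCBang C) = Suc (bang_level C)"
| "bang_level (BCOp f Ts C Us) = Suc (bang_level C)"

primrec cbn_level :: "'o lctx \<Rightarrow> nat" where
  "cbn_level LHole = 0"
| "cbn_level (LCLam c) = cbn_level c"
| "cbn_level (LCAppL c t) = cbn_level c"
| "cbn_level (LCAppR t c) = Suc (cbn_level c)"
| "cbn_level (LCOp f ts c us) = Suc (cbn_level c)"

fun cbv_level :: "'o lctx \<Rightarrow> nat" where
  "cbv_level LHole = 0"
| "cbv_level (LCLam c) = Suc (cbv_level c)"
| "cbv_level (LCAppL (LCLam c) t) = cbv_level c"
| "cbv_level (LCAppL c t) = cbv_level c"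
| "cbv_level (LCAppR t c) = cbv_level c"
| "cbv_level (LCOp f ts c us) = Suc (cbv_level c)"


section \<open>The calculi\<close>

definition lam_value :: "'o lam \<Rightarrow> bool" where
  "lam_value t \<longleftrightarrow> (\<exists>i. t = Var i) \<or> (\<exists>u. t = Lam u)"

definition beta :: "('o lam \<times> 'o lam) set" where
  "beta = {(App (Lam t) s, subst t s 0) | t s. True}"

definition beta_v :: "('o lam \<times> 'o lam) set" where
  "beta_v = {(App (Lam t) v, subst t v 0) | t v. lam_value v}"

definition bang_beta :: "('o bang \<times> 'o bang) set" where
  "bang_beta = {(BApp (BLam T) (Bang S), bsubst T S 0) | T S. True}"

text \<open>
  Rules need not be closed under substitution or renaming, nor apply to every \<open>f(t\<^sub>1, \<dots>, t\<^sub>k)\<close>.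
\<close>

definition operator_rules ::
  "'o set \<Rightarrow> ('o \<Rightarrow> nat) \<Rightarrow> ('o \<Rightarrow> ('o lam \<times> 'o lam) set) \<Rightarrow> bool" where
  "operator_rules Ops ar \<rho> \<longleftrightarrow>
     (\<forall>f \<in> Ops. \<forall>(t, s) \<in> \<rho> f. t \<in> lam_terms Ops ar \<and> s \<in> lam_terms Ops ar \<and> (\<exists>ts. t = Op f ts))"

definition cbn_calculus ::
  "'o set \<Rightarrow> ('o \<Rightarrow> nat) \<Rightarrow> ('o \<Rightarrow> ('o lam \<times> 'o lam) set) \<Rightarrow> ('o lam, 'o lctx) calculus" where
  "cbn_calculus Ops ar \<rho> =
     \<lparr>terms = lam_terms Ops ar, fill = lfill, level = cbn_level, root = beta \<union> (\<Union>f\<in>Ops. \<rho> f)\<rparr>"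

definition cbv_calculus ::
  "'o set \<Rightarrow> ('o \<Rightarrow> nat) \<Rightarrow> ('o \<Rightarrow> ('o lam \<times> 'o lam) set) \<Rightarrow> ('o lam, 'o lctx) calculus" where
  "cbv_calculus Ops ar \<rho> =
     \<lparr>terms = lam_terms Ops ar, fill = lfill, level = cbv_level, root = beta_v \<union> (\<Union>f\<in>Ops. \<rho> f)\<rparr>"

definition bang_calculus ::
  "'o set \<Rightarrow> ('o \<Rightarrow> nat) \<Rightarrow> ('o \<Rightarrow> ('o bang \<times> 'o bang) set) \<Rightarrow> ('o bang, 'o bctx) calculus" where
  "bang_calculus Ops ar \<rho> =
     \<lparr>terms = bang_terms Ops ar, fill = bfill, level = bang_level,
      root = bang_beta \<union> (\<Union>f\<in>Ops. \<rho> f)\<rparr>"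


section \<open>Translations\<close>

primrec cbn :: "'o lam \<Rightarrow> 'o bang" where
  "cbn (Var i) = BVar i"
| "cbn (Lam t) = BLam (cbn t)"
| "cbn (App t s) = BApp (cbn t) (Bang (cbn s))"
| "cbn (Op f ts) = BOp f (map cbn ts)"

primrec cbv :: "'o lam \<Rightarrow> 'o bang" where
  "cbv (Var i) = Bang (BVar i)"
| "cbv (Lam t) = Bang (BLam (cbv t))"
| "cbv (App t s) =
     (case cbv t of Bang T \<Rightarrow> BApp T (cbv s)
      | _ \<Rightarrow> BApp (BApp (BLam (BVar 0)) (cbv t)) (cbv s))"
| "cbv (Op f ts) = BOp f (map cbv ts)"

definition image_rules ::
  "('o lam \<Rightarrow> 'o bang) \<Rightarrow> ('o \<Rightarrow> ('o lam \<times> 'o lam) set) \<Rightarrow> 'o \<Rightarrow> ('o bang \<times> 'o bang) set" where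
  "image_rules tr \<rho> f = {(tr t, tr s) | t s. (t, s) \<in> \<rho> f}"

text \<open>
  Reducing inside an argument of an operator redex leaves an operator redex. This holds in
  particular when every \<open>f(t\<^sub>1, \<dots>, t\<^sub>k)\<close> is a left-hand side of the rule of \<open>f\<close>. Without it, least-level
  factorization does not transfer from the bang calculus to the call-by-value calculus: the bang
  calculus has additional intermediate terms \<open>((\<lambda>x. x) !T) S\<close>, which no translated left-hand side
  contains. So a bang reduction can pass through terms with no operator redex where every
  call-by-value reduction has to create such a redex and then destroy it by an internal step.
\<close>

definition operator_redexes_stable ::
  "'o set \<Rightarrow> ('o \<Rightarrow> ('o lam \<times> 'o lam) set) \<Rightarrow> ('o lam \<times> 'o lam) set \<Rightarrow> bool" where
  "operator_redexes_stable Ops \<rho> r \<longleftrightarrow>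
     (\<forall>f \<in> Ops. \<forall>ts t t' us. Op f (ts @ t # us) \<in> Domain (\<rho> f) \<and> (t, t') \<in> r \<longrightarrow>
        Op f (ts @ t' # us) \<in> Domain (\<rho> f))"

end

(*
  The call-by-name translation is a bisimulation that preserves levels, so both properties
  transfer at once.

  For call-by-value, a translated step may need a second, administrative step contracting an
  identity redex ((\<lambda>x. x) !V) in function position, at the same level. Such a pending redex hides
  the operator redexes above it, so least-level steps of the bang calculus do not project to
  least-level steps. Factorization is therefore transferred one level at a time: applying the
  hypothesis to a term placed next to a redex at level 0 gives T ->* S => T ->_0* ->_(>0)* S, and
  recursively ->_(>=k)* <= ->_k* ->_(>k)* for every k. This form projects to call-by-value, because
  no pending redex lies below the level under consideration. There the factorizations are chained,
  stopping at the first term with a redex below the current level; by stability of operator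
  redexes that redex survives all later steps, which are thus internal. The chain ends since the
  level of a step is bounded by the size of its target.

  For normalization, an infinite least-level reduction lifts to the bang calculus, where the
  administrative steps are least-level as well: a pending redex hides the operator redexes that
  could have appeared at lower levels.
*)

theory Submission
  imports Defs
begin

section \<open>Steps at a level\<close>

text \<open>Membership in \<open>terms K\<close> stays outside, because \<open>least_level\<close>
  counts every redex of the term, whatever its contractum.\<close>

definition step_at :: "('t, 'c) calculus \<Rightarrow> nat \<Rightarrow> 't \<Rightarrow> 't \<Rightarrow> bool" where
  "step_at K k T S \<longleftrightarrow>
     (\<exists>C R R'. (R, R') \<in> root K \<and> T = fill K C R \<and> S = fill K C R' \<and> level K C = k)"

lemma mem_red_iff:
  "(T, S) \<in> red K \<longleftrightarrow> T \<in> terms K \<and> S \<in> terms K \<and> (\<exists>k. step_at K k T S)"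
  unfolding red_def step_at_def by blast

lemma least_level_eq: "least_level K T = Inf (enat ` {k. \<exists>S. step_at K k T S})"
  unfolding least_level_def redexes_def step_at_def
  by (rule arg_cong[where f = Inf]) (auto simp: Domain_iff)

text \<open>Trades the infimum in \<open>enat\<close> for minimality among natural numbers; the
  given step makes the set of levels nonempty.\<close>

lemma eq_least_level_iff:
  assumes "step_at K k T S"
  shows "enat k = least_level K T \<longleftrightarrow> (\<forall>j U. step_at K j T U \<longrightarrow> k \<le> j)"
proof
  assume *: "enat k = least_level K T"
  have "enat k \<le> enat j" if "step_at K j T U" for j U
    unfolding * least_level_eq using that by (intro Inf_lower) auto
  then show "\<forall>j U. step_at K j T U \<longrightarrow> k \<le> j" by auto
next
  assume *: "\<forall>j U. step_at K j T U \<longrightarrow> k \<le> j"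
  show "enat k = least_level K T"
    unfolding least_level_eq
  proof (rule antisym)
    show "enat k \<le> Inf (enat ` {k. \<exists>S. step_at K k T S})"
      using * by (intro Inf_greatest) auto
    show "Inf (enat ` {k. \<exists>S. step_at K k T S}) \<le> enat k"
      using assms by (intro Inf_lower) auto
  qed
qed

lemma least_level_less_iff: "least_level K T < enat k \<longleftrightarrow> (\<exists>j<k. \<exists>U. step_at K j T U)"
  unfolding least_level_eq Inf_less_iff by auto

lemma mem_ll_red_iff:
  "(T, S) \<in> ll_red K \<longleftrightarrow> T \<in> terms K \<and> S \<in> terms K \<and>
     (\<exists>k. step_at K k T S \<and> (\<forall>j U. step_at K j T U \<longrightarrow> k \<le> j))"
proof -
  have "(T, S) \<in> ll_red K \<longleftrightarrow> T \<in> terms K \<and> S \<in> terms K \<and>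
     (\<exists>k. step_at K k T S \<and> enat k = least_level K T)"
    unfolding ll_red_def step_at_def by auto
  then show ?thesis using eq_least_level_iff by metis
qed

lemma mem_internal_red_iff:
  "(T, S) \<in> internal_red K \<longleftrightarrow> T \<in> terms K \<and> S \<in> terms K \<and>
     (\<exists>k. step_at K k T S \<and> (\<exists>j<k. \<exists>U. step_at K j T U))"
proof -
  have "(T, S) \<in> internal_red K \<longleftrightarrow> T \<in> terms K \<and> S \<in> terms K \<and>
     (\<exists>k. step_at K k T S \<and> least_level K T < enat k)"
    unfolding internal_red_def step_at_def by auto
  then show ?thesis by (simp add: least_level_less_iff)
qed

text \<open>Ensures that a redex of least level yields a step between terms; otherwise
  \<open>ll_red\<close> could be stuck on a term that \<open>red\<close> still reduces.\<close>

definition closed_terms :: "('t, 'c) calculus \<Rightarrow> bool" where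
  "closed_terms K \<longleftrightarrow> (\<forall>k T S. step_at K k T S \<longrightarrow> T \<in> terms K \<longrightarrow> S \<in> terms K)"

lemma ll_red_subset: "ll_red K \<subseteq> red K"
  by (auto simp: mem_ll_red_iff mem_red_iff)

lemma normal_ll_red_iff:
  assumes "closed_terms K"
  shows "normal (ll_red K) T \<longleftrightarrow> normal (red K) T"
proof
  assume n: "normal (ll_red K) T"
  show "normal (red K) T"
    unfolding normal_def
  proof
    assume "\<exists>S. (T, S) \<in> red K"
    then obtain k S where *: "T \<in> terms K" "step_at K k T S"
      by (auto simp: mem_red_iff)
    define m where "m = (LEAST k. \<exists>S. step_at K k T S)"
    have "\<exists>S. step_at K m T S"
      unfolding m_def by (rule LeastI_ex) (use *(2) in blast)
    then obtain S' where S': "step_at K m T S'" by blast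
    have "\<forall>j U. step_at K j T U \<longrightarrow> m \<le> j"
      unfolding m_def by (blast intro: Least_le)
    then have "(T, S') \<in> ll_red K"
      using S' * assms by (auto simp: mem_ll_red_iff closed_terms_def)
    with n show False by (auto simp: normal_def)
  qed
next
  show "normal (red K) T \<Longrightarrow> normal (ll_red K) T"
    using ll_red_subset by (auto simp: normal_def)
qed

section \<open>Normalization as absence of infinite least-level sequences\<close>

definition infinite_from :: "('t \<times> 't) set \<Rightarrow> 't \<Rightarrow> bool" where
  "infinite_from e t \<longleftrightarrow> (\<exists>f :: nat \<Rightarrow> 't. f 0 = t \<and> (\<forall>i. (f i, f (Suc i)) \<in> e))"

text \<open>With closed terms, inclusion and equality of normal forms hold in every calculus. Finite
  maximal sequences then end in a normal form, and only infinite ones have to be excluded.\<close>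

lemma ll_normalization_iff:
  assumes "closed_terms K"
  shows "ll_normalization K \<longleftrightarrow>
    (\<forall>T U. (T, U) \<in> (red K)\<^sup>* \<and> normal (red K) U \<longrightarrow> \<not> infinite_from (ll_red K) T)"
  unfolding ll_normalization_def normalizing_strategy_def maximal_seqs_end_in_nf_def
    infinite_from_def
  using ll_red_subset normal_ll_red_iff[OF assms] by blast

lemma infinite_from_simulation:
  assumes step: "\<And>x y. (x, y) \<in> r \<Longrightarrow> (f x, f y) \<in> e\<^sup>+"
    and "infinite_from r x"
  shows "infinite_from e (f x)"
proof -
  obtain g where g: "g 0 = x" "\<And>i. (g i, g (Suc i)) \<in> r"
    using assms(2) by (auto simp: infinite_from_def)
  \<comment> \<open>The invariant for choosing the next term: a later image is still ahead by at
    least one step, so a further \<open>e\<close>-step exists.\<close>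
  define P where "P y \<longleftrightarrow> (\<exists>i. (y, f (g i)) \<in> e\<^sup>+)" for y
  have P0: "P (f x)"
    unfolding P_def using step[OF g(2)[of 0]] g(1) by auto
  have PS: "\<exists>z. (y, z) \<in> e \<and> P z" if y: "P y" for y
  proof -
    obtain i where "(y, f (g i)) \<in> e\<^sup>+" using y unfolding P_def by blast
    then obtain z where z: "(y, z) \<in> e" "(z, f (g i)) \<in> e\<^sup>*" by (meson tranclD)
    then have "(z, f (g (Suc i))) \<in> e\<^sup>+"
      using step[OF g(2)[of i]] by (meson rtrancl_trancl_trancl)
    then show ?thesis using z by (auto simp: P_def)
  qed
  obtain h where "\<And>n. P (h n) \<and> (n = 0 \<longrightarrow> h n = f x)" "\<And>n. (h n, h (Suc n)) \<in> e"
    using dependent_nat_choice[of "\<lambda>n y. P y \<and> (n = 0 \<longrightarrow> y = f x)" "\<lambda>n y z. (y, z) \<in> e"]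
      P0 PS by auto
  then show ?thesis unfolding infinite_from_def by blast
qed

section \<open>Steps at one level and from a level on\<close>

definition at_lvl :: "(nat \<Rightarrow> 'a \<Rightarrow> 'a \<Rightarrow> bool) \<Rightarrow> nat \<Rightarrow> ('a \<times> 'a) set" where
  "at_lvl r k = {(x, y). r k x y}"

definition from_lvl :: "(nat \<Rightarrow> 'a \<Rightarrow> 'a \<Rightarrow> bool) \<Rightarrow> nat \<Rightarrow> ('a \<times> 'a) set" where
  "from_lvl r k = {(x, y). \<exists>l\<ge>k. r l x y}"

lemma at_lvl_iff: "(x, y) \<in> at_lvl r k \<longleftrightarrow> r k x y"
  by (simp add: at_lvl_def)

lemma from_lvl_iff: "(x, y) \<in> from_lvl r k \<longleftrightarrow> (\<exists>l\<ge>k. r l x y)"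
  by (simp add: from_lvl_def)

lemma from_lvl_step:
  "r l y z \<Longrightarrow> k \<le> l \<Longrightarrow> (x, y) \<in> (from_lvl r k)\<^sup>* \<Longrightarrow> (x, z) \<in> (from_lvl r k)\<^sup>*"
  by (rule rtrancl_into_rtrancl) (auto simp: from_lvl_iff)

lemma rtrancl_map_mono:
  assumes "(x, y) \<in> r\<^sup>*" and "\<And>x y. (x, y) \<in> r \<Longrightarrow> (f x, f y) \<in> s"
  shows "(f x, f y) \<in> s\<^sup>*"
  using assms(1) by induction (auto intro: assms(2) rtrancl_into_rtrancl)


section \<open>Levelled steps by induction on terms\<close>

text \<open>Contexts are absorbed into the rules, so inversion follows the outermost constructor of
  the term; \<open>oper\<close> accepts only pairs of \<open>rs\<close> whose left-hand side is
  headed by an operator.\<close>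

inductive bstep :: "('o bang \<times> 'o bang) set \<Rightarrow> nat \<Rightarrow> 'o bang \<Rightarrow> 'o bang \<Rightarrow> bool"
  for rs where
  beta: "bstep rs 0 (BApp (BLam T) (Bang S)) (bsubst T S 0)"
| oper: "(BOp f Ts, S) \<in> rs \<Longrightarrow> bstep rs 0 (BOp f Ts) S"
| lam: "bstep rs k T T' \<Longrightarrow> bstep rs k (BLam T) (BLam T')"
| appL: "bstep rs k T T' \<Longrightarrow> bstep rs k (BApp T S) (BApp T' S)"
| appR: "bstep rs k S S' \<Longrightarrow> bstep rs k (BApp T S) (BApp T S')"
| bang: "bstep rs k T T' \<Longrightarrow> bstep rs (Suc k) (Bang T) (Bang T')"
| arg: "bstep rs k T T' \<Longrightarrow> bstep rs (Suc k) (BOp f (Ts @ T # Us)) (BOp f (Ts @ T' # Us))"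

inductive_cases bstep_BVarE[elim!]: "bstep rs k (BVar i) S"
inductive_cases bstep_BLamE[elim!]: "bstep rs k (BLam T) S"
inductive_cases bstep_BAppE: "bstep rs k (BApp T U) S"
inductive_cases bstep_BangE[elim!]: "bstep rs k (Bang T) S"
inductive_cases bstep_BOpE: "bstep rs k (BOp f Ts) S"

inductive nstep :: "('o lam \<times> 'o lam) set \<Rightarrow> nat \<Rightarrow> 'o lam \<Rightarrow> 'o lam \<Rightarrow> bool"
  for rs where
  beta: "nstep rs 0 (App (Lam t) s) (subst t s 0)"
| oper: "(Op f ts, s) \<in> rs \<Longrightarrow> nstep rs 0 (Op f ts) s"
| lam: "nstep rs k t t' \<Longrightarrow> nstep rs k (Lam t) (Lam t')"
| appL: "nstep rs k t t' \<Longrightarrow> nstep rs k (App t s) (App t' s)"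
| appR: "nstep rs k s s' \<Longrightarrow> nstep rs (Suc k) (App t s) (App t s')"
| arg: "nstep rs k t t' \<Longrightarrow> nstep rs (Suc k) (Op f (ts @ t # us)) (Op f (ts @ t' # us))"

text \<open>\<open>appLam\<close> and \<open>appL\<close> follow the two clauses of
  \<open>cbv_level\<close> for \<open>LCAppL\<close>: a lambda in function position does not count.
  The side condition of \<open>appL\<close> keeps the two apart.\<close>

inductive vstep :: "('o lam \<times> 'o lam) set \<Rightarrow> nat \<Rightarrow> 'o lam \<Rightarrow> 'o lam \<Rightarrow> bool"
  for rs where
  beta: "lam_value v \<Longrightarrow> vstep rs 0 (App (Lam t) v) (subst t v 0)"
| oper: "(Op f ts, s) \<in> rs \<Longrightarrow> vstep rs 0 (Op f ts) s"
| lam: "vstep rs k t t' \<Longrightarrow> vstep rs (Suc k) (Lam t) (Lam t')"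
| appLam: "vstep rs k t t' \<Longrightarrow> vstep rs k (App (Lam t) s) (App (Lam t') s)"
| appL: "vstep rs k t t' \<Longrightarrow> \<forall>u. t \<noteq> Lam u \<Longrightarrow> vstep rs k (App t s) (App t' s)"
| appR: "vstep rs k s s' \<Longrightarrow> vstep rs k (App t s) (App t s')"
| arg: "vstep rs k t t' \<Longrightarrow> vstep rs (Suc k) (Op f (ts @ t # us)) (Op f (ts @ t' # us))"

inductive_cases vstep_VarE[elim!]: "vstep rs k (Var i) s"
inductive_cases vstep_LamE[elim!]: "vstep rs k (Lam t) s"
inductive_cases vstep_AppE: "vstep rs k (App t u) s"
inductive_cases vstep_OpE: "vstep rs k (Op f ts) s"

lemma bfill_bstep: "bstep rs k R R' \<Longrightarrow> bstep rs (k + bang_level C) (bfill C R) (bfill C R')"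
  by (induction C) (auto intro: bstep.intros)

lemma lfill_nstep: "nstep rs k R R' \<Longrightarrow> nstep rs (k + cbn_level C) (lfill C R) (lfill C R')"
  by (induction C) (auto intro: nstep.intros)

text \<open>An abstraction in the hole of \<open>LCAppL LHole t\<close> would fall under
  \<open>appLam\<close>, which computes another level. Redexes are never abstractions, so the side
  condition holds for them.\<close>

lemma lfill_vstep:
  assumes "vstep rs k R R'" "\<forall>u. R \<noteq> Lam u"
  shows "vstep rs (k + cbv_level C) (lfill C R) (lfill C R')"
proof (induction C)
  case (LCAppL C t)
  then show ?case using assms(2) by (cases C) (auto intro: vstep.intros)
qed (auto intro: vstep.intros assms)

lemma bstep_imp_context:
  "bstep rs k T S \<Longrightarrow>
    \<exists>C R R'. (R, R') \<in> bang_beta \<union> rs \<and> T = bfill C R \<and> S = bfill C R' \<and> bang_level C = k"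
proof (induction rule: bstep.induct)
  case (beta T S)
  show ?case by (intro exI[of _ BHole] exI) (auto simp: bang_beta_def)
next
  case (oper f Ts S)
  then show ?case by (intro exI[of _ BHole] exI) auto
next
  case (lam k T T')
  then show ?case by (metis bfill.simps(2) bang_level.simps(2))
next
  case (appL k T T' S)
  then show ?case by (metis bfill.simps(3) bang_level.simps(3))
next
  case (appR k S S' T)
  then show ?case by (metis bfill.simps(4) bang_level.simps(4))
next
  case (bang k T T')
  then show ?case by (metis bfill.simps(5) bang_level.simps(5))
next
  case (arg k T T' f Ts Us)
  then show ?case by (metis bfill.simps(6) bang_level.simps(6))
qed

lemma nstep_imp_context:
  "nstep rs k t s \<Longrightarrow>
    \<exists>c r r'. (r, r') \<in> beta \<union> rs \<and> t = lfill c r \<and> s = lfill c r' \<and> cbn_level c = k"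
proof (induction rule: nstep.induct)
  case (beta t s)
  show ?case by (intro exI[of _ LHole] exI) (auto simp: beta_def)
next
  case (oper f ts s)
  then show ?case by (intro exI[of _ LHole] exI) auto
next
  case (lam k t t')
  then show ?case by (metis lfill.simps(2) cbn_level.simps(2))
next
  case (appL k t t' s)
  then show ?case by (metis lfill.simps(3) cbn_level.simps(3))
next
  case (appR k s s' t)
  then show ?case by (metis lfill.simps(4) cbn_level.simps(4))
next
  case (arg k t t' f ts us)
  then show ?case by (metis lfill.simps(5) cbn_level.simps(5))
qed

lemma cbv_level_LCAppL:
  "\<forall>d. c \<noteq> LCLam d \<Longrightarrow> cbv_level (LCAppL c t) = cbv_level c"
  by (cases c) auto

lemma vstep_imp_context:
  "vstep rs k t s \<Longrightarrow>
    \<exists>c r r'. (r, r') \<in> beta_v \<union> rs \<and> t = lfill c r \<and> s = lfill c r' \<and> cbv_level c = k"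
proof (induction rule: vstep.induct)
  case (beta v t)
  then show ?case by (intro exI[of _ LHole] exI) (auto simp: beta_v_def)
next
  case (oper f ts s)
  then show ?case by (intro exI[of _ LHole] exI) auto
next
  case (lam k t t')
  then show ?case by (metis lfill.simps(2) cbv_level.simps(2))
next
  case (appLam k t t' s)
  then show ?case by (metis lfill.simps(2,3) cbv_level.simps(3))
next
  case (appL k t t' s)
  then obtain c r r' where
    *: "(r, r') \<in> beta_v \<union> rs" "t = lfill c r" "t' = lfill c r'" "cbv_level c = k" by blast
  then have "\<forall>d. c \<noteq> LCLam d" using appL.hyps by auto
  then show ?case using * by (metis lfill.simps(3) cbv_level_LCAppL)
next
  case (appR k s s' t)
  then show ?case by (metis lfill.simps(4) cbv_level.simps(8))
next
  case (arg k t t' f ts us)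
  then show ?case by (metis lfill.simps(5) cbv_level.simps(9))
qed

text \<open>A step at a positive level is not at the root and keeps the outermost constructor. It
  can therefore neither create nor destroy the bang that a !beta-redex waits for.\<close>

lemma bstep_Suc_Bang_iff:
  assumes "bstep rs (Suc k) T S"
  shows "(\<exists>U. T = Bang U) = (\<exists>U. S = Bang U)"
  using assms by (auto elim: bstep.cases)

lemma vstep_Suc_head_iff:
  assumes "vstep rs (Suc k) t s"
  shows "(\<exists>u. t = Lam u) = (\<exists>u. s = Lam u)" "lam_value t = lam_value s"
  using assms by (auto elim: vstep.cases simp: lam_value_def)


lemma step_at_bang:
  assumes "Domain rs \<subseteq> range (case_prod BOp)"
    and "root K = bang_beta \<union> rs" "fill K = bfill" "level K = bang_level"
  shows "step_at K = bstep rs"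
proof (intro ext iffI)
  fix k T S
  assume "step_at K k T S"
  then obtain C R R' where *: "(R, R') \<in> bang_beta \<union> rs" "T = bfill C R" "S = bfill C R'"
    "bang_level C = k"
    using assms by (auto simp: step_at_def)
  from *(1) have "bstep rs 0 R R'"
    using subsetD[OF assms(1) DomainI[of R R']] by (auto simp: bang_beta_def intro: bstep.intros)
  from bfill_bstep[OF this, of C] show "bstep rs k T S" using * by simp
next
  fix k T S
  show "bstep rs k T S \<Longrightarrow> step_at K k T S"
    using bstep_imp_context[of rs k T S] assms by (simp add: step_at_def)
qed

lemma step_at_cbn:
  assumes "Domain rs \<subseteq> range (case_prod Op)"
    and "root K = beta \<union> rs" "fill K = lfill" "level K = cbn_level"
  shows "step_at K = nstep rs"
proof (intro ext iffI)
  fix k t s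
  assume "step_at K k t s"
  then obtain c r r' where *: "(r, r') \<in> beta \<union> rs" "t = lfill c r" "s = lfill c r'"
    "cbn_level c = k"
    using assms by (auto simp: step_at_def)
  from *(1) have "nstep rs 0 r r'"
    using subsetD[OF assms(1) DomainI[of r r']] by (auto simp: beta_def intro: nstep.intros)
  from lfill_nstep[OF this, of c] show "nstep rs k t s" using * by simp
next
  fix k t s
  show "nstep rs k t s \<Longrightarrow> step_at K k t s"
    using nstep_imp_context[of rs k t s] assms by (simp add: step_at_def)
qed

lemma step_at_cbv:
  assumes "Domain rs \<subseteq> range (case_prod Op)"
    and "root K = beta_v \<union> rs" "fill K = lfill" "level K = cbv_level"
  shows "step_at K = vstep rs"
proof (intro ext iffI)
  fix k t s
  assume "step_at K k t s"
  then obtain c r r' where *: "(r, r') \<in> beta_v \<union> rs" "t = lfill c r" "s = lfill c r'"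
    "cbv_level c = k"
    using assms by (auto simp: step_at_def)
  from *(1) have "vstep rs 0 r r'" "\<forall>u. r \<noteq> Lam u"
    using subsetD[OF assms(1) DomainI[of r r']] by (auto simp: beta_v_def intro: vstep.intros)
  from lfill_vstep[OF this, of c] show "vstep rs k t s" using * by simp
next
  fix k t s
  show "vstep rs k t s \<Longrightarrow> step_at K k t s"
    using vstep_imp_context[of rs k t s] assms by (simp add: step_at_def)
qed

section \<open>Closure of the term sets under reduction and translation\<close>

inductive_cases lam_LamE[elim!]: "Lam t \<in> lam_terms Ops ar"
inductive_cases lam_AppE[elim!]: "App t s \<in> lam_terms Ops ar"
inductive_cases lam_OpE[elim!]: "Op f ts \<in> lam_terms Ops ar"
inductive_cases bang_BLamE[elim!]: "BLam t \<in> bang_terms Ops ar"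
inductive_cases bang_BAppE[elim!]: "BApp t s \<in> bang_terms Ops ar"
inductive_cases bang_BangE[elim!]: "Bang t \<in> bang_terms Ops ar"
inductive_cases bang_BOpE[elim!]: "BOp f ts \<in> bang_terms Ops ar"

lemma lift_lam_terms: "t \<in> lam_terms Ops ar \<Longrightarrow> lift t k \<in> lam_terms Ops ar"
  by (induction arbitrary: k rule: lam_terms.induct) (auto intro!: lam_terms.intros)

lemma subst_lam_terms:
  "t \<in> lam_terms Ops ar \<Longrightarrow> s \<in> lam_terms Ops ar \<Longrightarrow> subst t s k \<in> lam_terms Ops ar"
  by (induction arbitrary: k s rule: lam_terms.induct)
    (auto intro!: lam_terms.intros lift_lam_terms)

lemma blift_bang_terms: "t \<in> bang_terms Ops ar \<Longrightarrow> blift t k \<in> bang_terms Ops ar"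
  by (induction arbitrary: k rule: bang_terms.induct) (auto intro!: bang_terms.intros)

lemma bsubst_bang_terms:
  "t \<in> bang_terms Ops ar \<Longrightarrow> s \<in> bang_terms Ops ar \<Longrightarrow> bsubst t s k \<in> bang_terms Ops ar"
  by (induction arbitrary: k s rule: bang_terms.induct)
    (auto intro!: bang_terms.intros blift_bang_terms)

lemma bstep_bang_terms:
  assumes "Range rs \<subseteq> bang_terms Ops ar"
  shows "bstep rs k T S \<Longrightarrow> T \<in> bang_terms Ops ar \<Longrightarrow> S \<in> bang_terms Ops ar"
  by (induction rule: bstep.induct)
    (auto intro!: bang_terms.intros bsubst_bang_terms dest: RangeI[THEN subsetD[OF assms]])

lemma nstep_lam_terms:
  assumes "Range rs \<subseteq> lam_terms Ops ar"
  shows "nstep rs k t s \<Longrightarrow> t \<in> lam_terms Ops ar \<Longrightarrow> s \<in> lam_terms Ops ar"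
  by (induction rule: nstep.induct)
    (auto intro!: lam_terms.intros subst_lam_terms dest: RangeI[THEN subsetD[OF assms]])

lemma vstep_lam_terms:
  assumes "Range rs \<subseteq> lam_terms Ops ar"
  shows "vstep rs k t s \<Longrightarrow> t \<in> lam_terms Ops ar \<Longrightarrow> s \<in> lam_terms Ops ar"
  by (induction rule: vstep.induct)
    (auto intro!: lam_terms.intros subst_lam_terms dest: RangeI[THEN subsetD[OF assms]])

lemma cbn_bang_terms: "t \<in> lam_terms Ops ar \<Longrightarrow> cbn t \<in> bang_terms Ops ar"
  by (induction rule: lam_terms.induct) (auto intro!: bang_terms.intros)

lemma cbv_bang_terms: "t \<in> lam_terms Ops ar \<Longrightarrow> cbv t \<in> bang_terms Ops ar"
  by (induction rule: lam_terms.induct) (auto intro!: bang_terms.intros split: bang.split)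


section \<open>Call-by-name\<close>

text \<open>Counterpart of \<open>image_rules\<close> for the rules of all operators taken
  together.\<close>

definition image_pairs :: "('a \<Rightarrow> 'b) \<Rightarrow> ('a \<times> 'a) set \<Rightarrow> ('b \<times> 'b) set" where
  "image_pairs tr r = {(tr t, tr s) | t s. (t, s) \<in> r}"

text \<open>Serves to reverse \<open>image_pairs\<close>: an operator rule that applies to
  \<open>cbn t\<close> has the translation of \<open>t\<close> itself as its source, hence stems
  from a rule with source \<open>t\<close>.\<close>

lemma inj_cbn: "cbn t = cbn s \<longleftrightarrow> t = s"
proof (induction t arbitrary: s)
  case (Op f ts)
  have "map cbn ts = map cbn us \<longleftrightarrow> ts = us" for us
    using Op by (induction ts arbitrary: us) (auto simp: Cons_eq_map_conv)
  then show ?case by (cases s) auto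
qed (case_tac s; auto)+

lemma cbn_lift: "cbn (lift t k) = blift (cbn t) k"
  by (induction t arbitrary: k) auto

lemma cbn_subst: "cbn (subst t s k) = bsubst (cbn t) (cbn s) k"
  by (induction t arbitrary: s k) (auto simp: cbn_lift)

lemma nstep_cbn: "nstep rs k t s \<Longrightarrow> bstep (image_pairs cbn rs) k (cbn t) (cbn s)"
proof (induction rule: nstep.induct)
  case (oper f ts s)
  then show ?case by (auto intro!: bstep.oper simp: image_pairs_def) (metis cbn.simps(4))
qed (auto simp: cbn_subst intro: bstep.intros)

text \<open>Call-by-name introduces no auxiliary redexes: every argument is banged, so the
  translation of an application matches !beta exactly when its function is an abstraction. The bang
  raises the level of arguments by one, as \<open>cbn_level\<close> does.\<close>

lemma bstep_cbnD:
  assumes "Domain rs \<subseteq> range (case_prod Op)"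
  shows "bstep (image_pairs cbn rs) k (cbn t) S \<Longrightarrow> \<exists>s. S = cbn s \<and> nstep rs k t s"
proof (induction t arbitrary: k S)
  case (Var i)
  then show ?case by auto
next
  case (Lam t)
  then show ?case by (auto dest!: Lam.IH) (metis cbn.simps(2) nstep.lam)
next
  case (App t s)
  from App.prems have "bstep (image_pairs cbn rs) k (BApp (cbn t) (Bang (cbn s))) S" by simp
  then show ?case
  proof (cases rule: bstep_BAppE[consumes 1, case_names beta appL appR])
    case (beta T U)
    then obtain t' where "t = Lam t'" "T = cbn t'" by (cases t) auto
    then show ?thesis using beta
      by (auto simp: cbn_subst[symmetric] intro!: exI nstep.beta)
  next
    case (appL T')
    then show ?thesis
      by (auto dest!: App.IH(1)) (metis cbn.simps(3) nstep.appL)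
  next
    case (appR S')
    then show ?thesis
      by (auto dest!: App.IH(2)) (metis cbn.simps(3) nstep.appR)
  qed
next
  case (Op f ts)
  from Op.prems have "bstep (image_pairs cbn rs) k (BOp f (map cbn ts)) S" by simp
  then show ?case
  proof (cases rule: bstep_BOpE[consumes 1, case_names oper arg])
    case oper
    then obtain r s where *: "(r, s) \<in> rs" "BOp f (map cbn ts) = cbn r" "S = cbn s"
      by (auto simp: image_pairs_def)
    then have "cbn (Op f ts) = cbn r" by simp
    then have "r = Op f ts" by (simp only: inj_cbn)
    then show ?thesis using * oper by (auto intro: nstep.oper)
  next
    case (arg k' T T' Ts Us)
    then obtain as t bs where "ts = as @ t # bs" "Ts = map cbn as" "T = cbn t" "Us = map cbn bs"
      by (auto simp: map_eq_append_conv map_eq_Cons_conv)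
    then show ?thesis using arg Op.IH[of t k' T']
      by auto (metis cbn.simps(4) list.simps(9) map_append nstep.arg)
  qed
qed


section \<open>Transfer along a level-preserving embedding\<close>

text \<open>Since levels are preserved in both directions, \<open>t\<close> and \<open>f t\<close>
  have the same least level, and least-level and internal steps correspond. Injectivity identifies
  the end of the pulled-back sequence with \<open>s\<close>.\<close>

lemma transfer_by_bisimulation:
  assumes closed: "closed_terms K" "closed_terms K'"
    and terms: "\<And>t. t \<in> terms K \<Longrightarrow> f t \<in> terms K'"
    and inj: "inj f"
    and sim: "\<And>k t s. step_at K k t s \<Longrightarrow> step_at K' k (f t) (f s)"
    and refl: "\<And>k t S. step_at K' k (f t) S \<Longrightarrow> \<exists>s. S = f s \<and> step_at K k t s"
  shows "ll_factorization K' \<Longrightarrow> ll_factorization K"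
    and "ll_normalization K' \<Longrightarrow> ll_normalization K"
proof -
  have red: "(f t, f s) \<in> red K'" if "(t, s) \<in> red K" for t s
    using that sim terms by (auto simp: mem_red_iff)
  have reds: "(f t, f s) \<in> (red K')\<^sup>*" if "(t, s) \<in> (red K)\<^sup>*" for t s
    using that by (rule rtrancl_map_mono) (auto dest: red)
  have ll: "(f t, f s) \<in> ll_red K'" if "(t, s) \<in> ll_red K" for t s
  proof -
    obtain k where k: "step_at K k t s" "\<forall>j u. step_at K j t u \<longrightarrow> k \<le> j"
      using \<open>(t, s) \<in> ll_red K\<close> by (auto simp: mem_ll_red_iff)
    then have "\<forall>j U. step_at K' j (f t) U \<longrightarrow> k \<le> j" using refl by blast
    then show ?thesis
      using sim[OF k(1)] terms that by (auto simp: mem_ll_red_iff)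
  qed
  \<comment> \<open>Pulls a whole sequence back along \<open>f\<close>; applied to the least-level
    half and to the internal half.\<close>
  have star: "\<exists>s. S = f s \<and> s \<in> terms K \<and> (t, s) \<in> R\<^sup>*"
    if "(T, S) \<in> R'\<^sup>*" "T = f t" "t \<in> terms K"
      and R: "\<And>t S. t \<in> terms K \<Longrightarrow> (f t, S) \<in> R' \<Longrightarrow> \<exists>s. S = f s \<and> s \<in> terms K \<and> (t, s) \<in> R"
    for R R' T S t
    using that(1,2,3)
  proof induction
    case (step Y Z)
    then obtain y where y: "Y = f y" "y \<in> terms K" "(t, y) \<in> R\<^sup>*" by blast
    moreover obtain z where "Z = f z" "z \<in> terms K" "(y, z) \<in> R"
      using R[OF y(2)] step.hyps(2) y(1) by blast
    ultimately show ?case by (blast intro: rtrancl_into_rtrancl)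
  qed blast
  have llD: "\<exists>s. S = f s \<and> s \<in> terms K \<and> (t, s) \<in> ll_red K"
    if "t \<in> terms K" "(f t, S) \<in> ll_red K'" for t S
  proof -
    obtain k where k: "step_at K' k (f t) S" "\<forall>j U. step_at K' j (f t) U \<longrightarrow> k \<le> j"
      using \<open>(f t, S) \<in> ll_red K'\<close> by (auto simp: mem_ll_red_iff)
    then have "\<forall>j u. step_at K j t u \<longrightarrow> k \<le> j" using sim by blast
    then show ?thesis
      using refl[OF k(1)] closed(1) that(1) by (auto simp: mem_ll_red_iff closed_terms_def)
  qed
  have intD: "\<exists>s. S = f s \<and> s \<in> terms K \<and> (t, s) \<in> internal_red K"
    if "t \<in> terms K" "(f t, S) \<in> internal_red K'" for t S
  proof -
    obtain k j where k: "step_at K' k (f t) S" "j < k" "\<exists>U. step_at K' j (f t) U"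
      using \<open>(f t, S) \<in> internal_red K'\<close> by (auto simp: mem_internal_red_iff)
    then have "\<exists>u. step_at K j t u" using refl by blast
    then show ?thesis
      using refl[OF k(1)] k(2) closed(1) that(1)
      by (auto simp: mem_internal_red_iff closed_terms_def)
  qed
  show "ll_factorization K" if fact: "ll_factorization K'"
    unfolding ll_factorization_def
  proof (intro subrelI)
    fix t s
    assume ts: "(t, s) \<in> (red K)\<^sup>*"
    show "(t, s) \<in> (ll_red K)\<^sup>* O (internal_red K)\<^sup>*"
    proof (cases "t \<in> terms K")
      case True
      obtain U where U: "(f t, U) \<in> (ll_red K')\<^sup>*" "(U, f s) \<in> (internal_red K')\<^sup>*"
        using reds[OF ts] fact unfolding ll_factorization_def by blast
      obtain u where u: "U = f u" "u \<in> terms K" "(t, u) \<in> (ll_red K)\<^sup>*"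
        using star[OF U(1) HOL.refl True llD] by blast
      obtain s' where "f s = f s'" "(u, s') \<in> (internal_red K)\<^sup>*"
        using star[OF U(2) u(1,2) intD] by blast
      then show ?thesis using u inj by (auto dest: injD)
    next
      case False
      \<comment> \<open>No step starts outside \<open>terms K\<close>, so the sequence is
        empty.\<close>
      then have "t = s" using ts by (auto elim: converse_rtranclE simp: mem_red_iff)
      then show ?thesis by blast
    qed
  qed
  show "ll_normalization K" if norm: "ll_normalization K'"
    unfolding ll_normalization_iff[OF closed(1)]
  proof (intro allI impI notI)
    fix t u
    assume *: "(t, u) \<in> (red K)\<^sup>* \<and> normal (red K) u" "infinite_from (ll_red K) t"
    then have "t \<in> terms K" by (metis infinite_from_def mem_ll_red_iff)
    then have "u \<in> terms K" using * by (auto elim: rtranclE simp: mem_red_iff)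
    then have "\<not> step_at K k u s" for k s
      using * closed(1) unfolding normal_def mem_red_iff closed_terms_def by blast
    then have "normal (red K') (f u)"
      unfolding normal_def mem_red_iff by (blast dest: refl)
    moreover have "infinite_from (ll_red K') (f t)"
      by (rule infinite_from_simulation[OF _ *(2)]) (blast dest: ll)
    ultimately show False
      using norm reds * unfolding ll_normalization_iff[OF closed(2)] by blast
  qed
qed


section \<open>Level-by-level factorization in the bang calculus\<close>

text \<open>For \<open>k = 0\<close> the given sequence is arbitrary, so this is factorization into
  surface steps followed by deeper ones. The source is a parameter so that the property can be
  restricted to terms of the calculus.\<close>

definition lvl_fact :: "(nat \<Rightarrow> 'a \<Rightarrow> 'a \<Rightarrow> bool) \<Rightarrow> nat \<Rightarrow> 'a \<Rightarrow> bool" where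
  "lvl_fact r k t \<longleftrightarrow>
     (\<forall>s. (t, s) \<in> (from_lvl r k)\<^sup>* \<longrightarrow> (t, s) \<in> (at_lvl r k)\<^sup>* O (from_lvl r (Suc k))\<^sup>*)"

lemma list_all2_relcomp:
  "list_all2 (\<lambda>x y. (x, y) \<in> R O S) xs ys \<Longrightarrow>
    \<exists>zs. list_all2 (\<lambda>x y. (x, y) \<in> R) xs zs \<and> list_all2 (\<lambda>x y. (x, y) \<in> S) zs ys"
proof (induction rule: list_all2_induct)
  case (Cons x xs y ys)
  then obtain zs z where "list_all2 (\<lambda>x y. (x, y) \<in> R) xs zs"
    "list_all2 (\<lambda>x y. (x, y) \<in> S) zs ys" "(x, z) \<in> R" "(z, y) \<in> S" by blast
  then show ?case by (intro exI[of _ "z # zs"]) simp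
qed simp

text \<open>\<open>As\<close> holds the arguments already reduced, so that the induction can proceed
  from left to right; the intended case is the empty prefix.\<close>

lemma BOp_star_cong:
  assumes "list_all2 (\<lambda>T S. (T, S) \<in> R\<^sup>*) Ts Ss"
    and "\<And>T S As Bs. (T, S) \<in> R \<Longrightarrow> (BOp f (As @ T # Bs), BOp f (As @ S # Bs)) \<in> R'"
  shows "(BOp f (As @ Ts), BOp f (As @ Ss)) \<in> R'\<^sup>*"
  using assms(1)
proof (induction arbitrary: As rule: list_all2_induct)
  case (Cons T Ts S Ss)
  have "(BOp f (As @ T # Ts), BOp f (As @ S # Ts)) \<in> R'\<^sup>*"
    using Cons.hyps(1)
    by (rule rtrancl_map_mono[where f = "\<lambda>T. BOp f (As @ T # Ts)"]) (auto intro: assms(2))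
  also have "(BOp f (As @ S # Ts), BOp f (As @ S # Ss)) \<in> R'\<^sup>*"
    using Cons.IH[of "As @ [S]"] by simp
  finally show ?case .
qed simp

lemma BLam_starD:
  "(T, S) \<in> (from_lvl (bstep rs) k)\<^sup>* \<Longrightarrow> T = BLam T1 \<Longrightarrow>
    \<exists>S1. S = BLam S1 \<and> (T1, S1) \<in> (from_lvl (bstep rs) k)\<^sup>*"
  by (induction rule: rtrancl_induct)
    (auto simp: from_lvl_iff intro: from_lvl_step)

lemma Bang_starD:
  "(T, S) \<in> (from_lvl (bstep rs) (Suc k))\<^sup>* \<Longrightarrow> T = Bang T1 \<Longrightarrow>
    \<exists>S1. S = Bang S1 \<and> (T1, S1) \<in> (from_lvl (bstep rs) k)\<^sup>*"
  by (induction rule: rtrancl_induct)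
    (auto simp: from_lvl_iff intro: from_lvl_step)

text \<open>Root steps have level 0, so from a positive level on the two components evolve
  independently.\<close>

lemma BApp_starD:
  "(T, S) \<in> (from_lvl (bstep rs) (Suc k))\<^sup>* \<Longrightarrow> T = BApp T1 T2 \<Longrightarrow>
    \<exists>S1 S2. S = BApp S1 S2 \<and> (T1, S1) \<in> (from_lvl (bstep rs) (Suc k))\<^sup>* \<and>
      (T2, S2) \<in> (from_lvl (bstep rs) (Suc k))\<^sup>*"
  by (induction rule: rtrancl_induct)
    (auto simp: from_lvl_iff intro: from_lvl_step elim!: bstep_BAppE)

text \<open>Again no root step occurs, and the operator accounts for one level, so the bound for the
  arguments drops to \<open>k\<close>.\<close>

lemma BOp_starD:
  "(T, S) \<in> (from_lvl (bstep rs) (Suc k))\<^sup>* \<Longrightarrow> T = BOp f Ts \<Longrightarrow>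
    \<exists>Ss. S = BOp f Ss \<and> list_all2 (\<lambda>T S. (T, S) \<in> (from_lvl (bstep rs) k)\<^sup>*) Ts Ss"
proof (induction rule: rtrancl_induct)
  case base
  then show ?case by (auto intro: list_all2_refl)
next
  case (step S S')
  then obtain Ss where Ss: "S = BOp f Ss"
    "list_all2 (\<lambda>T S. (T, S) \<in> (from_lvl (bstep rs) k)\<^sup>*) Ts Ss" by blast
  from step.hyps(2) obtain l where l: "Suc k \<le> l" "bstep rs l (BOp f Ss) S'"
    by (auto simp: from_lvl_iff Ss)
  from l(2) show ?case
  proof (cases rule: bstep_BOpE[consumes 1, case_names oper arg])
    case oper
    then show ?thesis using l(1) by simp
  next
    case (arg l' U U' As Bs)
    then have "(U, U') \<in> from_lvl (bstep rs) k" using l(1) by (auto simp: from_lvl_iff)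
    moreover obtain Ts1 T Ts2 where "Ts = Ts1 @ T # Ts2"
      "list_all2 (\<lambda>T S. (T, S) \<in> (from_lvl (bstep rs) k)\<^sup>*) Ts1 As"
      "(T, U) \<in> (from_lvl (bstep rs) k)\<^sup>*"
      "list_all2 (\<lambda>T S. (T, S) \<in> (from_lvl (bstep rs) k)\<^sup>*) Ts2 Bs"
      using Ss(2) arg(2) by (auto simp: list_all2_append2 list_all2_Cons2)
    ultimately show ?thesis
      using arg by (auto intro!: list_all2_appendI intro: rtrancl_into_rtrancl)
  qed
qed

text \<open>Induction on the level outside and on the term inside. Under a bang or an operator the
  bound drops, so the outer hypothesis at \<open>k\<close> applies; lambda and application keep it,
  so their components use the inner one at \<open>Suc k\<close>.\<close>

lemma lvl_fact_bang:
  assumes "\<And>T. T \<in> bang_terms Ops ar \<Longrightarrow> lvl_fact (bstep rs) 0 T"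
  shows "T \<in> bang_terms Ops ar \<Longrightarrow> lvl_fact (bstep rs) k T"
proof (induction k arbitrary: T)
  case 0
  then show ?case by (rule assms)
next
  case (Suc k)
  let ?A = "\<lambda>k. at_lvl (bstep rs) k" and ?F = "\<lambda>k. from_lvl (bstep rs) k"
  from Suc.prems show ?case
  proof (induction rule: bang_terms.induct)
    case (1 i)
    have "S = BVar i" if "(BVar i, S) \<in> (?F (Suc k))\<^sup>*" for S
      using that by (induction rule: rtrancl_induct) (auto simp: from_lvl_iff)
    then show ?case by (auto simp: lvl_fact_def)
  next
    case (2 T)
    show ?case
      unfolding lvl_fact_def
    proof (intro allI impI)
      fix S
      assume "(BLam T, S) \<in> (?F (Suc k))\<^sup>*"
      then obtain S1 where S: "S = BLam S1" "(T, S1) \<in> (?F (Suc k))\<^sup>*"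
        using BLam_starD by blast
      then obtain M where M: "(T, M) \<in> (?A (Suc k))\<^sup>*" "(M, S1) \<in> (?F (Suc (Suc k)))\<^sup>*"
        using 2 by (auto simp: lvl_fact_def)
      have "(BLam T, BLam M) \<in> (?A (Suc k))\<^sup>*"
        using M(1) by (rule rtrancl_map_mono) (auto simp: at_lvl_iff intro: bstep.intros)
      moreover have "(BLam M, BLam S1) \<in> (?F (Suc (Suc k)))\<^sup>*"
        using M(2) by (rule rtrancl_map_mono) (auto simp: from_lvl_iff intro: bstep.intros)
      ultimately show "(BLam T, S) \<in> (?A (Suc k))\<^sup>* O (?F (Suc (Suc k)))\<^sup>*"
        using S by blast
    qed
  next
    case (3 T U)
    show ?case
      unfolding lvl_fact_def
    proof (intro allI impI)
      fix S
      assume "(BApp T U, S) \<in> (?F (Suc k))\<^sup>*"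
      then obtain T1 U1 where S: "S = BApp T1 U1" "(T, T1) \<in> (?F (Suc k))\<^sup>*"
        "(U, U1) \<in> (?F (Suc k))\<^sup>*"
        using BApp_starD by blast
      then have "(T, T1) \<in> (?A (Suc k))\<^sup>* O (?F (Suc (Suc k)))\<^sup>*"
        "(U, U1) \<in> (?A (Suc k))\<^sup>* O (?F (Suc (Suc k)))\<^sup>*"
        using 3(3,4) by (simp_all add: lvl_fact_def)
      then obtain M N where M: "(T, M) \<in> (?A (Suc k))\<^sup>*" "(M, T1) \<in> (?F (Suc (Suc k)))\<^sup>*"
        and N: "(U, N) \<in> (?A (Suc k))\<^sup>*" "(N, U1) \<in> (?F (Suc (Suc k)))\<^sup>*"
        by blast
      \<comment> \<open>The halves of both components are interleaved: first all steps at
        \<open>Suc k\<close>, then all deeper ones.\<close>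
      have "(BApp T U, BApp M U) \<in> (?A (Suc k))\<^sup>*"
        using M(1) by (rule rtrancl_map_mono) (auto simp: at_lvl_iff intro: bstep.intros)
      also have "(BApp M U, BApp M N) \<in> (?A (Suc k))\<^sup>*"
        using N(1) by (rule rtrancl_map_mono) (auto simp: at_lvl_iff intro: bstep.intros)
      finally have 1: "(BApp T U, BApp M N) \<in> (?A (Suc k))\<^sup>*" .
      have "(BApp M N, BApp T1 N) \<in> (?F (Suc (Suc k)))\<^sup>*"
        using M(2) by (rule rtrancl_map_mono[where f = "\<lambda>M. BApp M N"])
          (auto simp: from_lvl_iff intro: bstep.intros)
      also have "(BApp T1 N, BApp T1 U1) \<in> (?F (Suc (Suc k)))\<^sup>*"
        using N(2) by (rule rtrancl_map_mono) (auto simp: from_lvl_iff intro: bstep.intros)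
      finally have "(BApp M N, BApp T1 U1) \<in> (?F (Suc (Suc k)))\<^sup>*" .
      with 1 show "(BApp T U, S) \<in> (?A (Suc k))\<^sup>* O (?F (Suc (Suc k)))\<^sup>*"
        using S by blast
    qed
  next
    case (4 T)
    show ?case
      unfolding lvl_fact_def
    proof (intro allI impI)
      fix S
      assume "(Bang T, S) \<in> (?F (Suc k))\<^sup>*"
      then obtain S1 where S: "S = Bang S1" "(T, S1) \<in> (?F k)\<^sup>*"
        using Bang_starD by blast
      then obtain M where M: "(T, M) \<in> (?A k)\<^sup>*" "(M, S1) \<in> (?F (Suc k))\<^sup>*"
        using Suc.IH[OF 4(1)] by (auto simp: lvl_fact_def)
      have "(Bang T, Bang M) \<in> (?A (Suc k))\<^sup>*"
        using M(1) by (rule rtrancl_map_mono) (auto simp: at_lvl_iff intro: bstep.intros)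
      moreover have "(Bang M, Bang S1) \<in> (?F (Suc (Suc k)))\<^sup>*"
        using M(2) by (rule rtrancl_map_mono) (auto simp: from_lvl_iff intro: bstep.intros)
      ultimately show "(Bang T, S) \<in> (?A (Suc k))\<^sup>* O (?F (Suc (Suc k)))\<^sup>*"
        using S by blast
    qed
  next
    case (5 f Ts)
    show ?case
      unfolding lvl_fact_def
    proof (intro allI impI)
      fix S
      assume "(BOp f Ts, S) \<in> (?F (Suc k))\<^sup>*"
      from BOp_starD[OF this refl] obtain Ss where S: "S = BOp f Ss"
        "list_all2 (\<lambda>T S. (T, S) \<in> (?F k)\<^sup>*) Ts Ss"
        by (elim exE conjE)
      have "list_all2 (\<lambda>T S. (T, S) \<in> (?A k)\<^sup>* O (?F (Suc k))\<^sup>*) Ts Ss"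
        using S(2)
      proof (rule list.rel_mono_strong)
        fix T S
        assume "T \<in> set Ts" "(T, S) \<in> (?F k)\<^sup>*"
        moreover from this have "lvl_fact (bstep rs) k T" using 5 by (intro Suc.IH) simp
        ultimately show "(T, S) \<in> (?A k)\<^sup>* O (?F (Suc k))\<^sup>*" unfolding lvl_fact_def by blast
      qed
      then obtain Ms where M: "list_all2 (\<lambda>T S. (T, S) \<in> (?A k)\<^sup>*) Ts Ms"
        "list_all2 (\<lambda>T S. (T, S) \<in> (?F (Suc k))\<^sup>*) Ms Ss"
        by (elim list_all2_relcomp[THEN exE] conjE)
      have "(BOp f ([] @ Ts), BOp f ([] @ Ms)) \<in> (?A (Suc k))\<^sup>*"
        using M(1) by (rule BOp_star_cong) (auto simp: at_lvl_iff intro: bstep.intros)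
      moreover have "(BOp f ([] @ Ms), BOp f ([] @ Ss)) \<in> (?F (Suc (Suc k)))\<^sup>*"
        using M(2) by (rule BOp_star_cong) (auto simp: from_lvl_iff intro: bstep.intros)
      ultimately show "(BOp f Ts, S) \<in> (?A (Suc k))\<^sup>* O (?F (Suc (Suc k)))\<^sup>*"
        using S by auto
    qed
  qed
qed

lemma from_lvl_closed:
  assumes "Range rs \<subseteq> bang_terms Ops ar"
  shows "(T, S) \<in> (from_lvl (bstep rs) k)\<^sup>* \<Longrightarrow> T \<in> bang_terms Ops ar \<Longrightarrow> S \<in> bang_terms Ops ar"
proof (induction rule: rtrancl_induct)
  case (step S S')
  then show ?case by (auto simp: from_lvl_iff intro: bstep_bang_terms[OF assms])
qed

text \<open>
  Placing \<open>T\<close> next to a redex at level 0 whose contraction is irreversible forces the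
  least-level steps of a factorization to take place at level 0.
\<close>

lemma surface_factorization:
  assumes fact: "ll_factorization K" and K: "terms K = bang_terms Ops ar" "step_at K = bstep rs"
    and rs: "Range rs \<subseteq> bang_terms Ops ar"
    and T: "T \<in> bang_terms Ops ar"
  shows "lvl_fact (bstep rs) 0 T"
  unfolding lvl_fact_def
proof (intro allI impI)
  fix S
  assume TS: "(T, S) \<in> (from_lvl (bstep rs) 0)\<^sup>*"
  \<comment> \<open>The redex (\<lambda>y. x) !x, where x has index 0, hence 1 under the binder. Its
    only step is at level 0 and leaves the variable x, from which nothing leads back to
    \<open>X\<close>.\<close>
  define X where "X = (BApp (BLam (BVar 1)) (Bang (BVar 0)) :: 'a bang)"
  have X: "X \<in> bang_terms Ops ar" by (auto simp: X_def intro: bang_terms.intros)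
  have Xstep: "bstep rs k X Z \<longleftrightarrow> k = 0 \<and> Z = BVar 0" for k Z
  proof
    show "bstep rs k X Z \<Longrightarrow> k = 0 \<and> Z = BVar 0"
      unfolding X_def by (auto elim!: bstep_BAppE)
    show "k = 0 \<and> Z = BVar 0 \<Longrightarrow> bstep rs k X Z"
      unfolding X_def using bstep.beta[of rs "BVar 1" "BVar 0"] by simp
  qed
  have XU: "bstep rs k (BApp X U) Z \<longleftrightarrow>
    (k = 0 \<and> Z = BApp (BVar 0) U) \<or> (\<exists>U'. Z = BApp X U' \<and> bstep rs k U U')" for k U Z
  proof
    assume "bstep rs k (BApp X U) Z"
    then show "(k = 0 \<and> Z = BApp (BVar 0) U) \<or> (\<exists>U'. Z = BApp X U' \<and> bstep rs k U U')"
      by (rule bstep_BAppE) (simp_all add: X_def[symmetric] Xstep, simp add: X_def)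
  next
    assume "(k = 0 \<and> Z = BApp (BVar 0) U) \<or> (\<exists>U'. Z = BApp X U' \<and> bstep rs k U U')"
    then show "bstep rs k (BApp X U) Z" using Xstep[of k "BVar 0"] by (auto intro: bstep.intros)
  qed
  have VU: "bstep rs k (BApp (BVar i) U) Z \<Longrightarrow> \<exists>U'. Z = BApp (BVar i) U'" for k i U Z
    by (auto elim!: bstep_BAppE)
  have "(BApp X T, BApp X S) \<in> (red K)\<^sup>*"
    using TS
  proof (induction rule: rtrancl_induct)
    case (step U U')
    have "U \<in> bang_terms Ops ar" using from_lvl_closed[OF rs step.hyps(1) T] .
    moreover have "U' \<in> bang_terms Ops ar"
      using from_lvl_closed[OF rs rtrancl_into_rtrancl[OF step.hyps] T] .
    ultimately have "(BApp X U, BApp X U') \<in> red K"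
      using step.hyps(2) X
      by (auto simp: mem_red_iff K from_lvl_iff intro: bang_terms.intros bstep.intros)
    then show ?case by (rule rtrancl_into_rtrancl[OF step.IH])
  qed simp
  then obtain Y where Y: "(BApp X T, Y) \<in> (ll_red K)\<^sup>*" "(Y, BApp X S) \<in> (internal_red K)\<^sup>*"
    using fact by (auto simp: ll_factorization_def)
  \<comment> \<open>\<open>X\<close> always offers a step at level 0.\<close>
  have least: "k = 0" if "\<forall>j U'. bstep rs j (BApp X U) U' \<longrightarrow> k \<le> j" for k U
    using that XU by blast
  \<comment> \<open>Either \<open>X\<close> has been contracted, for good by \<open>VU\<close>, or
    all steps took place in \<open>T\<close> at level 0.\<close>
  have 1: "(\<exists>U. Y = BApp (BVar 0) U) \<or> (\<exists>U. Y = BApp X U \<and> (T, U) \<in> (at_lvl (bstep rs) 0)\<^sup>*)"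
    using Y(1)
  proof (induction rule: rtrancl_induct)
    case (step Y Y')
    from step.hyps(2) obtain k where k: "bstep rs k Y Y'" "\<forall>j U. bstep rs j Y U \<longrightarrow> k \<le> j"
      by (auto simp: mem_ll_red_iff K)
    from step.IH show ?case
    proof
      assume "\<exists>U. Y = BApp (BVar 0) U"
      then show ?thesis using k(1) VU by blast
    next
      assume "\<exists>U. Y = BApp X U \<and> (T, U) \<in> (at_lvl (bstep rs) 0)\<^sup>*"
      then obtain U where U: "Y = BApp X U" "(T, U) \<in> (at_lvl (bstep rs) 0)\<^sup>*" by blast
      then have "k = 0" using least k(2) by blast
      then consider "Y' = BApp (BVar 0) U" | U' where "Y' = BApp X U'" "bstep rs 0 U U'"
        using k(1) XU[of k U Y'] U(1) by auto
      then show ?thesis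
      proof cases
        case 2
        then have "(T, U') \<in> (at_lvl (bstep rs) 0)\<^sup>*"
          using U(2) by (auto simp: at_lvl_iff intro: rtrancl_into_rtrancl)
        then show ?thesis using 2 by blast
      qed blast
    qed
  qed simp
  have 2: "(\<exists>U'. Z = BApp (BVar 0) U') \<or>
      (\<exists>U U'. Y = BApp X U \<and> Z = BApp X U' \<and> (U, U') \<in> (from_lvl (bstep rs) 1)\<^sup>*)"
    if "(Y, Z) \<in> (internal_red K)\<^sup>*" for Z
    using that
  proof (induction rule: rtrancl_induct)
    case base
    then show ?case using 1 by blast
  next
    case (step Z Z')
    from step.hyps(2) obtain k where k: "bstep rs k Z Z'" "0 < k"
      by (auto simp: mem_internal_red_iff K)
    from step.IH show ?case
    proof
      assume "\<exists>U'. Z = BApp (BVar 0) U'"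
      then show ?thesis using k(1) VU by blast
    next
      assume "\<exists>U U'. Y = BApp X U \<and> Z = BApp X U' \<and> (U, U') \<in> (from_lvl (bstep rs) 1)\<^sup>*"
      then obtain U U' where U: "Y = BApp X U" "Z = BApp X U'"
        "(U, U') \<in> (from_lvl (bstep rs) 1)\<^sup>*" by (elim exE conjE)
      then obtain U'' where "Z' = BApp X U''" "bstep rs k U' U''"
        using k XU[of k U' Z'] by auto
      then show ?thesis using U k(2) from_lvl_step[of "bstep rs" k U' U'' 1 U] by auto
    qed
  qed
  \<comment> \<open>The target \<open>BApp X S\<close> still contains \<open>X\<close>, which
    excludes the first alternatives.\<close>
  from 2[OF Y(2)] 1 show "(T, S) \<in> (at_lvl (bstep rs) 0)\<^sup>* O (from_lvl (bstep rs) (Suc 0))\<^sup>*"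
    by (auto simp: X_def)
qed


section \<open>Call-by-value\<close>

text \<open>
  A value \<open>v\<close> in function position is translated without the bang around it. The translation
  of a function position that is not a value passes through an identity redex, which becomes
  contractible once the function has been evaluated.
\<close>

abbreviation BI :: "'o bang" where "BI \<equiv> BLam (BVar 0)"

definition fun_pos :: "'o bang \<Rightarrow> 'o bang" where
  "fun_pos T = (case T of Bang U \<Rightarrow> U | _ \<Rightarrow> BApp BI T)"

lemma fun_pos_simps[simp]:
  "fun_pos (Bang U) = U"
  "\<forall>U. T \<noteq> Bang U \<Longrightarrow> fun_pos T = BApp BI T"
  by (auto simp: fun_pos_def split: bang.split)

lemma cbv_App: "cbv (App t s) = BApp (fun_pos (cbv t)) (cbv s)"
  by (auto simp: fun_pos_def split: bang.split)

declare cbv.simps(3)[simp del] cbv_App[simp]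

lemma cbv_eq_Bang_iff:
  "cbv t = Bang T \<longleftrightarrow> (\<exists>i. t = Var i \<and> T = BVar i) \<or> (\<exists>u. t = Lam u \<and> T = BLam (cbv u))"
  by (cases t) auto

lemma cbv_not_Bang: "\<not> lam_value t \<Longrightarrow> \<forall>T. cbv t \<noteq> Bang T"
  by (auto simp: cbv_eq_Bang_iff lam_value_def)

lemma cbv_lift: "cbv (lift t k) = blift (cbv t) k"
proof (induction t arbitrary: k)
  case (App t s)
  have "fun_pos (blift T k) = blift (fun_pos T) k" for T
    by (cases T) auto
  then show ?case using App by simp
qed auto

text \<open>Variables are translated with a bang of their own, so it is the content \<open>S\<close>
  of the value that is substituted: under that bang it becomes \<open>cbv s\<close> again.\<close>

lemma cbv_subst:
  "cbv s = Bang S \<Longrightarrow> cbv (subst t s k) = bsubst (cbv t) S k"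
proof (induction t arbitrary: s S k)
  case (Lam t)
  have "cbv (lift s 0) = Bang (blift S 0)" by (simp add: cbv_lift Lam.prems)
  then show ?case by (simp add: Lam.IH)
next
  case (App t u)
  \<comment> \<open>Substitution could expose a bang only at a bare variable, and a translation is
    never one.\<close>
  have "fun_pos (bsubst (cbv t) S k) = bsubst (fun_pos (cbv t)) S k"
    by (cases t) (auto simp: fun_pos_def split: bang.split)
  then show ?case using App by simp
qed auto

text \<open>
  \<open>proj e t\<close> says that \<open>e\<close> is the translation of \<open>t\<close> up to pending identity redexes
  \<open>(\<lambda>x. x) !V\<close> in function position; \<open>no_pending e k\<close> says that \<open>e\<close> has no such redex at a
  level below \<open>k\<close>.
\<close>

inductive proj :: "'o bang \<Rightarrow> 'o lam \<Rightarrow> bool" where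
  var: "proj (Bang (BVar i)) (Var i)"
| lam: "proj e t \<Longrightarrow> proj (Bang (BLam e)) (Lam t)"
| app_value: "proj (Bang V) t \<Longrightarrow> proj e s \<Longrightarrow> proj (BApp V e) (App t s)"
| app: "proj d t \<Longrightarrow> proj e s \<Longrightarrow> proj (BApp (BApp BI d) e) (App t s)"
| oper: "list_all2 proj es ts \<Longrightarrow> proj (BOp f es) (Op f ts)"

inductive_cases proj_BangE: "proj (Bang V) t"
inductive_cases proj_BOpE: "proj (BOp f es) t"

primrec no_pending :: "'o bang \<Rightarrow> nat \<Rightarrow> bool" where
  "no_pending (BVar i) k \<longleftrightarrow> True"
| "no_pending (BLam T) k \<longleftrightarrow> no_pending T k"
| "no_pending (BApp T S) k \<longleftrightarrow>
     no_pending T k \<and> no_pending S k \<and> (k = 0 \<or> T \<noteq> BI \<or> (\<forall>W. S \<noteq> Bang W))"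
| "no_pending (Bang T) k \<longleftrightarrow> no_pending T (k - 1)"
| "no_pending (BOp f Ts) k \<longleftrightarrow> (\<forall>b \<in> set (map (\<lambda>T. no_pending T (k - 1)) Ts). b)"

text \<open>No level lies below 0, so the truncated \<open>k - 1\<close> in the clauses for
  \<open>Bang\<close> and \<open>BOp\<close> is harmless.\<close>

lemma no_pending_0[simp]: "no_pending T 0"
  by (induction T) auto

lemma proj_Bang_iff:
  "proj (Bang V) t \<longleftrightarrow>
     (\<exists>i. V = BVar i \<and> t = Var i) \<or> (\<exists>e u. V = BLam e \<and> t = Lam u \<and> proj e u)"
  by (auto elim: proj_BangE intro: proj.intros)

lemma proj_value: "proj (Bang V) t \<Longrightarrow> lam_value t"
  by (auto simp: proj_Bang_iff lam_value_def)

lemma proj_cbv: "proj (cbv t) t"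
proof (induction t)
  case (App t s)
  show ?case
  proof (cases "\<exists>V. cbv t = Bang V")
    case True
    then show ?thesis using App by (auto intro: proj.app_value)
  next
    case False
    then show ?thesis using App by (auto intro: proj.app)
  qed
next
  case (Op f ts)
  then show ?case by (auto intro!: proj.oper simp: list_all2_map1 list_all2_same)
qed (auto intro: proj.intros)

text \<open>\<open>app_value\<close> and \<open>app\<close> do not overlap: the function in the
  former is a variable or an abstraction, in the latter an application. With
  \<open>proj_cbv\<close>, a translation therefore projects to its source only.\<close>

lemma proj_unique: "proj e t \<Longrightarrow> proj e s \<Longrightarrow> t = s"
proof (induction arbitrary: s rule: proj.induct)
  case (app_value V t e u)
  have "V \<noteq> BApp BI d" for d using app_value.hyps(1) by (auto simp: proj_Bang_iff)
  with app_value.prems obtain t' u' where "s = App t' u'" "proj (Bang V) t'" "proj e u'"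
    by (cases rule: proj.cases) auto
  then show ?case using app_value.IH by blast
next
  case (app d t e u)
  obtain t' u' where "s = App t' u'" "proj d t'" "proj e u'"
    using app.prems by (cases rule: proj.cases) (auto simp: proj_Bang_iff)
  then show ?case using app.IH by blast
next
  case (oper es ts f)
  from oper.prems obtain us where us: "s = Op f us" "list_all2 proj es us"
    by (auto elim: proj_BOpE)
  have "ts = us"
    using oper.IH us(2)
  proof (induction arbitrary: us rule: list_all2_induct)
    case (Cons e es t ts)
    then show ?case by (cases us) auto
  qed simp
  then show ?case using us by simp
next
  case (lam e t)
  from lam.prems obtain u where "s = Lam u" "proj e u" by (auto simp: proj_Bang_iff)
  then show ?case using lam.IH by blast
next
  case (var i)
  then show ?case by (simp add: proj_Bang_iff)
qed

lemma proj_blift: "proj e t \<Longrightarrow> proj (blift e k) (lift t k)"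
proof (induction arbitrary: k rule: proj.induct)
  case (oper es ts f)
  then show ?case by (auto intro!: proj.oper simp: list_all2_conv_all_nth)
qed (auto intro: proj.intros)

text \<open>As in \<open>cbv_subst\<close>, the content of the bang is substituted;
  \<open>BI\<close> is closed, so pending redexes survive as such.\<close>

lemma proj_bsubst:
  "proj e t \<Longrightarrow> proj (Bang S) s \<Longrightarrow> proj (bsubst e S k) (subst t s k)"
proof (induction arbitrary: k S s rule: proj.induct)
  case (lam e t)
  then show ?case using proj_blift[of "Bang S" s 0] by (auto intro: proj.intros)
next
  case (oper es ts f)
  then show ?case by (auto intro!: proj.oper simp: list_all2_conv_all_nth)
qed (auto intro: proj.intros)

lemma cbv_neq: "cbv t \<noteq> BVar i" "cbv t \<noteq> BLam T"
  by (cases t; simp)+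

text \<open>Where the translation inserts \<open>BI\<close>, the argument is no bang; and a
  translated abstraction never has the form \<open>Bang BI\<close>, because its body is not a bare
  variable.\<close>

lemma no_pending_cbv: "no_pending (cbv t) k"
proof (induction t arbitrary: k)
  case (App t s)
  have "fun_pos (cbv t) \<noteq> BI"
    by (cases "cbv t") (auto simp: cbv_eq_Bang_iff cbv_neq)
  moreover have "no_pending (fun_pos (cbv t)) k"
  proof (cases "\<exists>V. cbv t = Bang V")
    case True
    \<comment> \<open>\<open>fun_pos\<close> strips a bang, so the hypothesis is taken one level
      deeper.\<close>
    then show ?thesis using App(1)[of "Suc k"] by auto
  next
    case False
    then show ?thesis using App(1)[of k] by auto
  qed
  ultimately show ?case using App(2) by simp
qed auto

lemma bstep_BI: "\<not> bstep rs k BI S"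
  by auto

lemma bstep_to_BI: "\<not> bstep rs (Suc k) T BI"
  by (auto elim: bstep.cases)

text \<open>If \<open>k\<close> is positive, so is the level of the step, and such a step neither
  creates nor destroys \<open>BI\<close> or a bang. The equivalence is used in both
  directions.\<close>

lemma no_pending_bstep: "bstep rs l T S \<Longrightarrow> k \<le> l \<Longrightarrow> no_pending T k \<longleftrightarrow> no_pending S k"
proof (induction arbitrary: k rule: bstep.induct)
  case (appL l T T' S)
  have "k \<noteq> 0 \<Longrightarrow> T \<noteq> BI \<and> T' \<noteq> BI"
    using appL.hyps bstep_BI bstep_to_BI appL.prems by (metis Suc_pred' le_zero_eq neq0_conv)
  then show ?case using appL by auto
next
  case (appR l S S' T)
  have "k \<noteq> 0 \<Longrightarrow> (\<exists>W. S = Bang W) = (\<exists>W. S' = Bang W)"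
    using appR.hyps appR.prems bstep_Suc_Bang_iff by (metis Suc_pred' le_zero_eq neq0_conv)
  then show ?case using appR by auto
next
  case (bang l T T')
  then show ?case by (cases k) auto
next
  case (arg l T T' f Ts Us)
  then show ?case by (cases k) auto
qed auto

lemma no_pending_from_lvl:
  "(T, S) \<in> (from_lvl (bstep rs) k)\<^sup>* \<Longrightarrow> no_pending T k \<longleftrightarrow> no_pending S k"
  by (induction rule: rtrancl_induct) (auto simp: from_lvl_iff no_pending_bstep)

lemma list_all2_cbv: "list_all2 proj (map cbv us) ts \<Longrightarrow> us = ts"
  by (induction us arbitrary: ts) (auto simp: list_all2_Cons1 dest: proj_unique[OF proj_cbv])


section \<open>Projecting bang steps to call-by-value steps\<close>

lemma cbv_eq_BOp_iff: "cbv r = BOp f es \<longleftrightarrow> (\<exists>us. r = Op f us \<and> es = map cbv us)"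
  by (cases r) auto

text \<open>The levels on both sides differ only inside \<open>BApp BI (Bang _)\<close>, where the
  bang counts but the abstraction in function position does not. \<open>no_pending e k\<close> keeps
  these places above level \<open>k\<close>, so steps never project below \<open>k\<close>, and
  steps at \<open>k\<close> project to steps at \<open>k\<close>. Contracting a pending redex leaves
  the projection unchanged.\<close>

lemma proj_bstep:
  "proj e t \<Longrightarrow> bstep (image_pairs cbv rs) l e e' \<Longrightarrow> k \<le> l \<Longrightarrow> no_pending e k \<Longrightarrow>
    (proj e' t \<and> (l = k \<longrightarrow> \<not> no_pending e (Suc k))) \<or>
    (\<exists>t' l'. vstep rs l' t t' \<and> k \<le> l' \<and> (l = k \<longrightarrow> l' = k) \<and> proj e' t')"
proof (induction arbitrary: k l e' rule: proj.induct)
  case (var i)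
  then show ?case by auto
next
  case (lam e t)
  from lam.prems(1) obtain l0 e1 where l0: "l = Suc l0" "e' = Bang (BLam e1)"
    "bstep (image_pairs cbv rs) l0 e e1" by auto
  \<comment> \<open>For \<open>k = 0\<close> the truncated bound is still valid, and
    \<open>l = k\<close> cannot occur since \<open>l\<close> is a successor.\<close>
  have "k - 1 \<le> l0" "no_pending e (k - 1)" using lam.prems l0 by auto
  from lam.IH[OF l0(3) this] show ?case
  proof (elim disjE exE conjE)
    assume *: "proj e1 t" "l0 = k - 1 \<longrightarrow> \<not> no_pending e (Suc (k - 1))"
    have "l = k \<longrightarrow> \<not> no_pending e k" using *(2) l0(1) by auto
    then show ?thesis using * l0 by (auto intro: proj.lam)
  next
    fix t' l' assume "vstep rs l' t t'" "k - 1 \<le> l'" "l0 = k - 1 \<longrightarrow> l' = k - 1" "proj e1 t'"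
    then show ?thesis using l0
      by (intro disjI2 exI[of _ "Lam t'"] exI[of _ "Suc l'"]) (auto intro: vstep.lam proj.lam)
  qed
next
  case (app_value V t e s)
  from app_value.prems(1) show ?case
  proof (cases rule: bstep_BAppE[consumes 1, case_names beta appL appR])
    case (beta T S)
    then obtain u where u: "t = Lam u" "proj T u" using app_value.hyps(1) by (auto simp: proj_Bang_iff)
    have "proj e' (subst u s 0)" "lam_value s"
      using beta u app_value.hyps(2) proj_bsubst proj_value by blast+
    then show ?thesis using beta u app_value.prems
      by (intro disjI2 exI[of _ "subst u s 0"] exI[of _ 0]) (auto intro: vstep.beta)
  next
    case (appL V')
    \<comment> \<open>The hypothesis speaks of \<open>Bang V\<close>, so the step is wrapped in a
      bang and all levels shift by one; \<open>appLam\<close> later shifts back.\<close>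
    have "bstep (image_pairs cbv rs) (Suc l) (Bang V) (Bang V')" using appL by (auto intro: bstep.bang)
    moreover have "Suc k \<le> Suc l" "no_pending (Bang V) (Suc k)" using app_value.prems by auto
    ultimately have "(proj (Bang V') t \<and> (Suc l = Suc k \<longrightarrow> \<not> no_pending (Bang V) (Suc (Suc k)))) \<or>
      (\<exists>t' l'. vstep rs l' t t' \<and> Suc k \<le> l' \<and> (Suc l = Suc k \<longrightarrow> l' = Suc k) \<and> proj (Bang V') t')"
      by (rule app_value.IH(1))
    then show ?thesis
    proof (elim disjE exE conjE)
      assume "proj (Bang V') t" "Suc l = Suc k \<longrightarrow> \<not> no_pending (Bang V) (Suc (Suc k))"
      then show ?thesis using appL app_value.hyps(2) by (auto intro: proj.app_value)
    next
      fix t' l'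
      assume *: "vstep rs l' t t'" "Suc k \<le> l'" "Suc l = Suc k \<longrightarrow> l' = Suc k" "proj (Bang V') t'"
      obtain u where u: "t = Lam u" using *(1) app_value.hyps(1) by (auto simp: proj_Bang_iff)
      then obtain l'' u' where "l' = Suc l''" "t' = Lam u'" "vstep rs l'' u u'" using *(1) by auto
      then show ?thesis using * appL u app_value.hyps(2)
        by (intro disjI2 exI[of _ "App t' s"] exI[of _ l''])
          (auto intro: vstep.appLam proj.app_value)
    qed
  next
    case (appR e1)
    have "no_pending e k" using app_value.prems by simp
    from app_value.IH(2)[OF appR(2) app_value.prems(2) this] show ?thesis
    proof (elim disjE exE conjE)
      assume "proj e1 s" "l = k \<longrightarrow> \<not> no_pending e (Suc k)"
      then show ?thesis using appR app_value.hyps(1) by (auto intro: proj.app_value)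
    next
      fix s' l'
      assume "vstep rs l' s s'" "k \<le> l'" "l = k \<longrightarrow> l' = k" "proj e1 s'"
      then show ?thesis using appR app_value.hyps(1)
        by (intro disjI2 exI[of _ "App t s'"] exI[of _ l']) (auto intro: vstep.appR proj.app_value)
    qed
  qed
next
  case (app d t e s)
  from app.prems(1) show ?case
  proof (cases rule: bstep_BAppE[consumes 1, case_names beta appL appR])
    case (appL D)
    from appL(2) show ?thesis
    proof (cases rule: bstep_BAppE[consumes 1, case_names beta appL appR])
      \<comment> \<open>The pending redex itself is contracted: \<open>app\<close> gives way to
        \<open>app_value\<close> over the same projection.\<close>
      case (beta T S)
      then have "proj e' (App t s)" using appL app.hyps by (auto intro: proj.app_value)
      moreover have "\<not> no_pending (BApp (BApp BI d) e) (Suc k)" using beta by simp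
      ultimately show ?thesis by blast
    next
      case (appR d')
      have e': "e' = BApp (BApp BI d') e" using appR appL by simp
      have "no_pending d k" using app.prems by simp
      from app.IH(1)[OF appR(2) app.prems(2) this] show ?thesis
      proof (elim disjE exE conjE)
        assume "proj d' t" "l = k \<longrightarrow> \<not> no_pending d (Suc k)"
        then show ?thesis using e' app.hyps(2) by (auto intro: proj.app)
      next
        fix t' l'
        assume *: "vstep rs l' t t'" "k \<le> l'" "l = k \<longrightarrow> l' = k" "proj d' t'"
        have p: "proj e' (App t' s)" using * e' app.hyps(2) by (auto intro: proj.app)
        show ?thesis
        proof (cases "\<exists>u. t = Lam u")
          case True
          then obtain u where u: "t = Lam u" by blast
          then obtain l'' u' where l'': "l' = Suc l''" "t' = Lam u'" "vstep rs l'' u u'"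
            using *(1) by auto
          \<comment> \<open>An abstraction as function makes \<open>BApp BI d\<close> a pending
            redex, so \<open>k\<close> is 0 and losing one level does no harm; \<open>l = k\<close>
            is impossible, as \<open>l\<close> counts the bang.\<close>
          obtain W where W: "d = Bang W" using app.hyps(1) u by (auto elim: proj.cases)
          then have "k = 0" using app.prems(3) by simp
          moreover have "l \<noteq> 0" using appR(2) W by auto
          ultimately show ?thesis using p u l''
            by (intro disjI2 exI[of _ "App t' s"] exI[of _ l'']) (auto intro: vstep.appLam)
        next
          case False
          then show ?thesis using p *
            by (intro disjI2 exI[of _ "App t' s"] exI[of _ l']) (auto intro: vstep.appL)
        qed
      qed
    qed auto
  next
    case (appR e1)
    have "no_pending e k" using app.prems by simp
    from app.IH(2)[OF appR(2) app.prems(2) this] show ?thesis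
    proof (elim disjE exE conjE)
      assume "proj e1 s" "l = k \<longrightarrow> \<not> no_pending e (Suc k)"
      then show ?thesis using appR app.hyps(1) by (auto intro: proj.app)
    next
      fix s' l'
      assume "vstep rs l' s s'" "k \<le> l'" "l = k \<longrightarrow> l' = k" "proj e1 s'"
      then show ?thesis using appR app.hyps(1)
        by (intro disjI2 exI[of _ "App t s'"] exI[of _ l']) (auto intro: vstep.appR proj.app)
    qed
  qed auto
next
  case (oper es ts f)
  from oper.prems(1) show ?case
  proof (cases rule: bstep_BOpE[consumes 1, case_names oper arg])
    case oper
    then obtain r s where r: "(r, s) \<in> rs" "cbv r = BOp f es" "e' = cbv s"
      by (auto simp: image_pairs_def)
    then obtain us where us: "(Op f us, s) \<in> rs" "es = map cbv us"
      by (auto simp: cbv_eq_BOp_iff)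
    \<comment> \<open>Rules match exact translations only, so the arguments hide no pending redex
      and project to \<open>us\<close> alone.\<close>
    have "list_all2 proj (map cbv us) ts"
      using \<open>list_all2 _ es ts\<close> us(2) by (auto elim: list.rel_mono_strong)
    then have "us = ts" by (rule list_all2_cbv)
    then show ?thesis using us r(3) oper \<open>k \<le> l\<close>
      by (intro disjI2 exI[of _ s] exI[of _ 0]) (auto intro: vstep.oper proj_cbv)
  next
    case (arg l0 T T' As Bs)
    \<comment> \<open>The induction hypothesis as a predicate, so that it can be split along with
      the argument list.\<close>
    let ?P = "\<lambda>e t. proj e t \<and> (\<forall>l e' k. bstep (image_pairs cbv rs) l e e' \<longrightarrow> k \<le> l \<longrightarrow> no_pending e k \<longrightarrow>
      (proj e' t \<and> (l = k \<longrightarrow> \<not> no_pending e (Suc k))) \<or>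
      (\<exists>t' l'. vstep rs l' t t' \<and> k \<le> l' \<and> (l = k \<longrightarrow> l' = k) \<and> proj e' t'))"
    have "list_all2 ?P (As @ T # Bs) ts"
      using oper.IH arg(2) by (auto elim!: list.rel_mono_strong)
    then obtain as t bs where ts: "ts = as @ t # bs" "list_all2 ?P As as" "?P T t" "list_all2 ?P Bs bs"
      by (auto simp only: list_all2_append1 list_all2_Cons1)
    have ps: "list_all2 proj As as" "list_all2 proj Bs bs"
      using ts(2,4) by (auto elim!: list.rel_mono_strong)
    have pr: "proj (BOp f (As @ T' # Bs)) (Op f (as @ t' # bs))" if "proj T' t'" for t'
      using that ps by (intro proj.oper list_all2_appendI) auto
    have "k - 1 \<le> l0" "no_pending T (k - 1)" using oper.prems arg by auto
    with ts(3) arg have "(proj T' t \<and> (l0 = k - 1 \<longrightarrow> \<not> no_pending T (Suc (k - 1)))) \<or>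
      (\<exists>t' l'. vstep rs l' t t' \<and> k - 1 \<le> l' \<and> (l0 = k - 1 \<longrightarrow> l' = k - 1) \<and> proj T' t')"
      by blast
    then show ?thesis
    proof (elim disjE exE conjE)
      assume *: "proj T' t" "l0 = k - 1 \<longrightarrow> \<not> no_pending T (Suc (k - 1))"
      have "l = k \<longrightarrow> \<not> no_pending T k" using *(2) arg by auto
      then show ?thesis using pr[OF *(1)] ts(1) arg by auto
    next
      fix t' l'
      assume *: "vstep rs l' t t'" "k - 1 \<le> l'" "l0 = k - 1 \<longrightarrow> l' = k - 1" "proj T' t'"
      then show ?thesis using pr[OF *(4)] ts(1) arg
        by (intro disjI2 exI[of _ "Op f (as @ t' # bs)"] exI[of _ "Suc l'"])
          (auto intro: vstep.arg)
    qed
  qed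
qed

text \<open>Taking the level of the step as the bound, the first alternative of
  \<open>proj_bstep\<close> would require a pending redex, and a translation has none.\<close>

lemma bstep_cbvD:
  assumes "bstep (image_pairs cbv rs) k (cbv t) S"
  shows "\<exists>s. vstep rs k t s"
  using proj_bstep[OF proj_cbv assms order_refl no_pending_cbv] no_pending_cbv by blast

text \<open>The sequence is translated, factorized in the bang calculus and projected back half by
  half. Projecting the second half with bound \<open>Suc k\<close> requires a midpoint without
  pending redexes at level \<open>k\<close>.\<close>

lemma lvl_fact_cbv:
  assumes fact: "lvl_fact (bstep (image_pairs cbv rs)) k (cbv t)"
    and sim: "\<And>l t s. vstep rs l t s \<Longrightarrow> (cbv t, cbv s) \<in> (at_lvl (bstep (image_pairs cbv rs)) l)\<^sup>*"
  shows "lvl_fact (vstep rs) k t"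
  unfolding lvl_fact_def
proof (intro allI impI)
  let ?B = "bstep (image_pairs cbv rs)"
  fix s
  assume "(t, s) \<in> (from_lvl (vstep rs) k)\<^sup>*"
  then have "(cbv t, cbv s) \<in> (from_lvl ?B k)\<^sup>*"
  proof (induction rule: rtrancl_induct)
    case (step u v)
    then obtain l where l: "k \<le> l" "vstep rs l u v" by (auto simp: from_lvl_iff)
    then have "at_lvl ?B l \<subseteq> from_lvl ?B k" by (auto simp: at_lvl_iff from_lvl_iff)
    then have "(cbv u, cbv v) \<in> (from_lvl ?B k)\<^sup>*" using sim[OF l(2)] rtrancl_mono by blast
    with step.IH show ?case by (rule rtrancl_trans)
  qed simp
  then obtain U where U: "(cbv t, U) \<in> (at_lvl ?B k)\<^sup>*" "(U, cbv s) \<in> (from_lvl ?B (Suc k))\<^sup>*"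
    using fact by (auto simp: lvl_fact_def)
  have "\<exists>u. proj U u \<and> (t, u) \<in> (at_lvl (vstep rs) k)\<^sup>* \<and> no_pending U k"
    using U(1)
  proof (induction rule: rtrancl_induct)
    case base
    then show ?case using proj_cbv no_pending_cbv by blast
  next
    case (step X Y)
    then obtain x where x: "proj X x" "(t, x) \<in> (at_lvl (vstep rs) k)\<^sup>*" "no_pending X k" by blast
    have XY: "?B k X Y" using step.hyps(2) by (simp add: at_lvl_iff)
    then have "no_pending Y k" using x(3) no_pending_bstep by blast
    moreover have "(t, x') \<in> (at_lvl (vstep rs) k)\<^sup>*" if "vstep rs k x x'" for x'
      using x(2) that by (auto simp: at_lvl_iff intro: rtrancl_into_rtrancl)
    ultimately show ?case
      using proj_bstep[OF x(1) XY order_refl x(3)] x(2) by blast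
  qed
  then obtain u where u: "proj U u" "(t, u) \<in> (at_lvl (vstep rs) k)\<^sup>*" by blast
  \<comment> \<open>Steps from \<open>Suc k\<close> on preserve \<open>no_pending\<close> backwards
    too, and the target is a translation.\<close>
  have U_no: "no_pending U (Suc k)"
    using no_pending_from_lvl[OF U(2)] no_pending_cbv by blast
  have "\<exists>v. proj Z v \<and> (u, v) \<in> (from_lvl (vstep rs) (Suc k))\<^sup>* \<and> no_pending Z (Suc k)"
    if "(U, Z) \<in> (from_lvl ?B (Suc k))\<^sup>*" for Z
    using that
  proof (induction rule: rtrancl_induct)
    case base
    then show ?case using u(1) U_no by blast
  next
    case (step X Y)
    from step.IH obtain x where x: "proj X x"
      "(u, x) \<in> (from_lvl (vstep rs) (Suc k))\<^sup>*" "no_pending X (Suc k)" by blast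
    obtain l where XY: "?B l X Y" "Suc k \<le> l" using step.hyps(2) by (auto simp: from_lvl_iff)
    then have "no_pending Y (Suc k)" using x(3) no_pending_bstep by blast
    with proj_bstep[OF x(1) XY x(3)] x(2) show ?case
      by (meson from_lvl_step)
  qed
  from this[OF U(2)] obtain v where "proj (cbv s) v" "(u, v) \<in> (from_lvl (vstep rs) (Suc k))\<^sup>*"
    by blast
  then have "(u, s) \<in> (from_lvl (vstep rs) (Suc k))\<^sup>*" using proj_unique[OF proj_cbv] by blast
  with u(2) show "(t, s) \<in> (at_lvl (vstep rs) k)\<^sup>* O (from_lvl (vstep rs) (Suc k))\<^sup>*" by blast
qed

text \<open>A step at a positive level preserves abstractions and values, so beta-redexes above it
  survive; operator redexes survive by stability, and redexes at disjoint positions are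
  untouched.\<close>

lemma vstep_persist:
  assumes stable: "\<And>f ts a l a' us. Op f (ts @ a # us) \<in> Domain rs \<Longrightarrow> a \<in> lam_terms Ops ar \<Longrightarrow>
    vstep rs l a a' \<Longrightarrow> Op f (ts @ a' # us) \<in> Domain rs"
  shows "vstep rs j t u \<Longrightarrow> vstep rs l t t' \<Longrightarrow> j < l \<Longrightarrow> t \<in> lam_terms Ops ar \<Longrightarrow>
    \<exists>u'. vstep rs j t' u'"
proof (induction arbitrary: l t' rule: vstep.induct)
  case (beta v t)
  then obtain l' where l': "l = Suc l'" by (cases l) auto
  from beta.prems(1) show ?case
  proof (cases rule: vstep_AppE[consumes 1, case_names beta appLam appL appR])
    case (appR v')
    then have "lam_value v'" using beta.hyps vstep_Suc_head_iff(2) l' by blast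
    then show ?thesis using appR by (auto intro: vstep.beta)
  qed (use beta l' in \<open>auto intro: vstep.beta\<close>)
next
  case (oper f ts s)
  from oper.prems(1) show ?case
  proof (cases rule: vstep_OpE[consumes 1, case_names oper arg])
    case (arg l' a a' as bs)
    then have "Op f (as @ a' # bs) \<in> Domain rs"
      using oper by (intro stable[of f as a bs l' a']) auto
    then show ?thesis using arg by (auto intro: vstep.oper)
  qed (use oper in auto)
next
  case (lam k t s)
  then obtain l' s' where "l = Suc l'" "t' = Lam s'" "vstep rs l' t s'" by auto
  then show ?case using lam.IH[of l' s'] lam.prems by (auto intro: vstep.lam)
next
  case (appLam k t t1 s)
  from appLam.prems(1) show ?case
  proof (cases rule: vstep_AppE[consumes 1, case_names beta appLam appL appR])
    case (appLam t2 t2')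
    then show ?thesis using appLam.IH[of l t2'] appLam.prems by (auto intro: vstep.appLam)
  next
    case (appR s')
    then show ?thesis using appLam.hyps by (auto intro: vstep.appLam)
  qed (use appLam.prems in auto)
next
  case (appL k t t1 s)
  then obtain l' where l': "l = Suc l'" by (cases l) auto
  from appL.prems(1) show ?case
  proof (cases rule: vstep_AppE[consumes 1, case_names beta appLam appL appR])
    case (appL t2)
    then have "\<forall>u. t2 \<noteq> Lam u" using vstep_Suc_head_iff(1) l' by blast
    then show ?thesis using appL appL.IH[of l t2] appL.prems by (auto intro: vstep.appL)
  next
    case (appR s')
    then show ?thesis using appL.hyps by (auto intro: vstep.appL)
  qed (use appL in auto)
next
  case (appR k s s1 t)
  from appR.prems(1) show ?case
  proof (cases rule: vstep_AppE[consumes 1, case_names beta appLam appL appR])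
    case (appR s')
    then show ?thesis using appR.IH[of l s'] appR.prems by (auto intro: vstep.appR)
  qed (use appR in \<open>auto intro: vstep.appR\<close>)
next
  case (arg k t t1 f ts us)
  from arg.prems(1) show ?case
  proof (cases rule: vstep_OpE[consumes 1, case_names oper arg])
    case oper
    then show ?thesis using arg.prems by simp
  next
    case (arg l' a a' as bs)
    note eq = \<open>ts @ t # us = as @ a # bs\<close>
    \<comment> \<open>The persisting redex lies to the left of the reduced argument, in it, or to
      its right.\<close>
    then consider cs where "as = ts @ t # cs" "us = cs @ a # bs"
      | "ts = as" "t = a" "us = bs" | cs where "ts = as @ a # cs" "bs = cs @ t # us"
      by (auto simp: append_eq_append_conv2 append_eq_Cons_conv Cons_eq_append_conv)
    then show ?thesis
    proof cases
      case 1
      then show ?thesis using arg vstep.arg[OF arg.hyps, of f ts "cs @ a' # bs"] by auto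
    next
      case 2
      then obtain a'' where "vstep rs k a' a''" using arg arg.IH[of l' a'] arg.prems by auto
      from vstep.arg[OF this, of f as bs] show ?thesis using arg by auto
    next
      case 3
      then show ?thesis using arg vstep.arg[OF arg.hyps, of f "as @ a' # cs" us] by auto
    qed
  qed
qed


text \<open>A step inside an application or operator term leaves a term of the same kind, which is
  no value; only a contraction at the root remains.\<close>

lemma vstep_not_value_to_value:
  assumes "vstep rs k t s" "\<forall>u. t \<noteq> Lam u" "lam_value s"
  shows "(\<exists>u v. lam_value v \<and> t = App (Lam u) v \<and> s = subst u v 0) \<or>
    (\<exists>f ts. t = Op f ts \<and> (t, s) \<in> rs)"
  using assms by (cases rule: vstep.cases) (auto simp: lam_value_def)

lemma BOp_notin_range_cbv: "e \<notin> range cbv \<Longrightarrow> BOp f (Ts @ e # Us) \<notin> range cbv"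
proof
  assume "e \<notin> range cbv" "BOp f (Ts @ e # Us) \<in> range cbv"
  then obtain r where "cbv r = BOp f (Ts @ e # Us)" by (metis rangeE)
  then obtain us where "Ts @ e # Us = map cbv us" by (auto simp: cbv_eq_BOp_iff)
  then have "e \<in> set (map cbv us)" by (metis in_set_conv_decomp)
  with \<open>e \<notin> range cbv\<close> show False by auto
qed

text \<open>
  The intermediate term \<open>e\<close> contains a pending identity redex, so no operator redex on the
  path to it is visible; hence \<open>e\<close> has no redex at a lower level that was not there before.
\<close>

lemma vstep_cbv:
  assumes rs: "Domain rs \<subseteq> range (case_prod Op)"
  defines "B \<equiv> bstep (image_pairs cbv rs)"
  shows "vstep rs k t s \<Longrightarrow> B k (cbv t) (cbv s) \<or>
    (\<exists>e. e \<notin> range cbv \<and> B k (cbv t) e \<and> B k e (cbv s) \<and>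
      (\<forall>j U. j < k \<longrightarrow> B j e U \<longrightarrow> (\<exists>U'. B j (cbv t) U')))"
    (is "_ \<Longrightarrow> _ \<or> (\<exists>e. ?Q k t s e)")
proof (induction rule: vstep.induct)
  case (beta v t)
  then obtain V where "cbv v = Bang V" by (auto simp: lam_value_def)
  then show ?case using cbv_subst[of v V t 0]
    by (intro disjI1) (simp add: B_def bstep.beta)
next
  case (oper f ts s)
  then have "(BOp f (map cbv ts), cbv s) \<in> image_pairs cbv rs"
    by (force simp: image_pairs_def)
  then show ?case by (intro disjI1) (simp add: B_def bstep.oper)
next
  case (lam k t t')
  from lam.IH show ?case
  proof (elim disjE exE)
    fix e assume e: "?Q k t t' e"
    have "Bang (BLam e) \<noteq> cbv r" for r
      using e by (cases r) auto
    then have "Bang (BLam e) \<notin> range cbv" by blast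
    moreover have "\<exists>U'. B j (cbv (Lam t)) U'" if jk: "j < Suc k" "B j (Bang (BLam e)) U" for j U
    proof -
      from jk(2) obtain j' U0 where "j = Suc j'" "B j' e U0" by (auto simp: B_def)
      then obtain U' where "B j' (cbv t) U'" using e jk(1) by auto
      then show ?thesis using \<open>j = Suc j'\<close> by (auto simp: B_def intro: bstep.intros)
    qed
    ultimately show ?thesis
      using e by (intro disjI2 exI[of _ "Bang (BLam e)"]) (simp_all add: B_def bstep.intros)
  qed (simp_all add: B_def bstep.intros)
next
  case (appLam k t t' s)
  from appLam.IH show ?case
  proof (elim disjE exE)
    fix e assume e: "?Q k t t' e"
    have "BApp (BLam e) (cbv s) \<noteq> cbv r" for r
    proof (cases r)
      case (App a b)
      have "fun_pos (cbv a) \<noteq> BLam e"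
        using e by (cases "cbv a") (auto simp: cbv_eq_Bang_iff)
      then show ?thesis using App by auto
    qed auto
    then have "BApp (BLam e) (cbv s) \<notin> range cbv" by blast
    moreover have "\<exists>U'. B j (cbv (App (Lam t) s)) U'"
      if jk: "j < k" "B j (BApp (BLam e) (cbv s)) U" for j U
      using jk(2)[unfolded B_def]
    proof (cases rule: bstep_BAppE[consumes 1, case_names beta appL appR])
      case (appL T')
      then obtain U0 where "B j e U0" by (auto simp: B_def)
      then obtain U' where "B j (cbv t) U'" using e jk(1) by auto
      then show ?thesis by (auto simp: B_def intro: bstep.intros)
    qed (auto simp: B_def intro: bstep.intros)
    ultimately show ?thesis
      using e by (intro disjI2 exI[of _ "BApp (BLam e) (cbv s)"])
        (simp_all add: B_def bstep.intros)
  qed (simp_all add: B_def bstep.intros)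
next
  case (appL k t t' s)
  have "\<not> lam_value t" using appL.hyps by (auto simp: lam_value_def)
  then have t: "\<forall>T. cbv t \<noteq> Bang T" by (rule cbv_not_Bang)
  \<comment> \<open>Two ways to leave the range: \<open>e\<close> is no translation itself, or
    \<open>e\<close> is a bang, in front of which no translation puts \<open>BI\<close>.\<close>
  have notin: "BApp (BApp BI e) S \<notin> range cbv" if "e \<notin> range cbv \<or> (\<exists>V. e = Bang V)" for e S
  proof
    assume "BApp (BApp BI e) S \<in> range cbv"
    then obtain r where r: "cbv r = BApp (BApp BI e) S" by auto
    then obtain a b where "r = App a b" by (cases r) auto
    then have *: "fun_pos (cbv a) = BApp BI e" using r by simp
    show False
    proof (cases "\<exists>V. cbv a = Bang V")
      case True
      then show False using * by (auto simp: cbv_eq_Bang_iff)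
    next
      case False
      then have "cbv a = e" using * by simp
      then show False using that False by auto
    qed
  qed
  show ?case
  proof (cases "lam_value t'")
    case True
    then obtain V where V: "cbv t' = Bang V" by (auto simp: lam_value_def)
    \<comment> \<open>Only a root contraction turns the non-value \<open>t\<close> into a value.
      Hence \<open>k\<close> is 0, and no lower level remains to be checked.\<close>
    from vstep_not_value_to_value[OF appL.hyps True]
    have root: "k = 0 \<and> B 0 (cbv t) (cbv t')"
    proof (elim disjE exE conjE)
      fix u v assume *: "lam_value v" "t = App (Lam u) v" "t' = subst u v 0"
      then have "k = 0" using appL.hyps(1) True vstep_Suc_head_iff(2)[of rs "k - 1" t t']
        by (cases k) (auto simp: lam_value_def)
      obtain W where "cbv v = Bang W" using *(1) by (auto simp: lam_value_def)
      then show ?thesis using * \<open>k = 0\<close> cbv_subst[of v W u 0]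
        by (auto simp: B_def intro: bstep.beta)
    next
      fix f ts assume *: "t = Op f ts" "(t, t') \<in> rs"
      then have "k = 0" using appL.hyps(1) True vstep_Suc_head_iff(2)[of rs "k - 1" t t']
        by (cases k) (auto simp: lam_value_def)
      have "(cbv t, cbv t') \<in> image_pairs cbv rs" using *(2) by (auto simp: image_pairs_def)
      then show ?thesis using *(1) \<open>k = 0\<close> by (auto simp: B_def intro: bstep.oper)
    qed
    have "B 0 (BApp (BApp BI (Bang V)) (cbv s)) (BApp V (cbv s))"
      using bstep.beta[of _ "BVar 0" V] by (auto simp: B_def intro: bstep.intros)
    moreover have "B 0 (BApp (BApp BI (cbv t)) (cbv s)) (BApp (BApp BI (Bang V)) (cbv s))"
      using root V by (auto simp: B_def intro: bstep.intros)
    ultimately have "?Q k (App t s) (App t' s) (BApp (BApp BI (Bang V)) (cbv s))"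
      using root t V notin[of "Bang V"] by simp
    then show ?thesis by blast
  next
    case False
    then have t': "\<forall>T. cbv t' \<noteq> Bang T" by (rule cbv_not_Bang)
    from appL.IH show ?thesis
    proof (elim disjE exE)
      fix e assume e: "?Q k t t' e"
      have "\<exists>U'. B j (cbv (App t s)) U'"
        if jk: "j < k" "B j (BApp (BApp BI e) (cbv s)) U" for j U
        using jk(2)[unfolded B_def]
      proof (cases rule: bstep_BAppE[consumes 1, case_names beta appL appR])
        case (appL T')
        from appL(2) show ?thesis
        proof (cases rule: bstep_BAppE[consumes 1, case_names beta appL appR])
          case (beta T S)
          \<comment> \<open>At a positive level a step to a bang starts from a bang, but
            \<open>t\<close> is no value.\<close>
          obtain k' where "k = Suc k'" using jk(1) by (cases k) auto
          then have "\<exists>V. cbv t = Bang V"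
            using e beta bstep_Suc_Bang_iff[of "image_pairs cbv rs" k' "cbv t" e] by (auto simp: B_def)
          then show ?thesis using t by blast
        next
          case (appR S')
          then obtain U' where "B j (cbv t) U'" using e jk(1) by (auto simp: B_def)
          then show ?thesis using t by (auto simp: B_def intro: bstep.intros)
        qed auto
      next
        case (appR S')
        then show ?thesis using t by (auto simp: B_def intro: bstep.intros)
      qed auto
      then show ?thesis
        using e t t' notin[of e "cbv s"] by (intro disjI2 exI[of _ "BApp (BApp BI e) (cbv s)"])
          (simp_all add: B_def bstep.intros)
    qed (use t t' in \<open>simp_all add: B_def bstep.intros\<close>)
  qed
next
  case (appR k s s' t)
  from appR.IH show ?case
  proof (elim disjE exE)
    fix e assume e: "?Q k s s' e"
    have "BApp (fun_pos (cbv t)) e \<noteq> cbv r" for r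
      using e by (cases r) auto
    then have "BApp (fun_pos (cbv t)) e \<notin> range cbv" by blast
    moreover have "\<exists>U'. B j (cbv (App t s)) U'"
      if jk: "j < k" "B j (BApp (fun_pos (cbv t)) e) U" for j U
      using jk(2)[unfolded B_def]
    proof (cases rule: bstep_BAppE[consumes 1, case_names beta appL appR])
      case (beta T S)
      \<comment> \<open>The step from \<open>cbv s\<close> to \<open>e\<close> has a positive level,
        so \<open>cbv s\<close> is a bang already and the redex was there before.\<close>
      obtain k' where "k = Suc k'" using jk(1) by (cases k) auto
      then obtain V where "cbv s = Bang V"
        using e beta bstep_Suc_Bang_iff[of "image_pairs cbv rs" k' "cbv s" e] by (auto simp: B_def)
      then show ?thesis using beta by (auto simp: B_def intro: bstep.beta)
    next
      case (appL T')
      then show ?thesis by (auto simp: B_def intro: bstep.intros)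
    next
      case (appR S')
      then obtain U' where "B j (cbv s) U'" using e jk(1) by (auto simp: B_def)
      then show ?thesis by (auto simp: B_def intro: bstep.intros)
    qed
    ultimately show ?thesis
      using e by (intro disjI2 exI[of _ "BApp (fun_pos (cbv t)) e"])
        (simp_all add: B_def bstep.intros)
  qed (simp_all add: B_def bstep.intros)
next
  case (arg k t t' f ts us)
  from arg.IH show ?case
  proof (elim disjE exE)
    fix e assume e: "?Q k t t' e"
    let ?e = "BOp f (map cbv ts @ e # map cbv us)"
    have notin: "?e \<notin> range cbv" using e by (intro BOp_notin_range_cbv) simp
    moreover have "\<exists>U'. B j (cbv (Op f (ts @ t # us))) U'" if jk: "j < Suc k" "B j ?e U" for j U
      using jk(2)[unfolded B_def]
    proof (cases rule: bstep_BOpE[consumes 1, case_names oper arg])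
      case oper
      \<comment> \<open>Left-hand sides of the rules are translations, which the term around
        \<open>e\<close> is not.\<close>
      then have "?e \<in> range cbv" by (auto simp: image_pairs_def)
      with notin show ?thesis by blast
    next
      case (arg j' T T' As Bs)
      note eq = \<open>map cbv ts @ e # map cbv us = As @ T # Bs\<close>
      then consider Cs where "As = map cbv ts @ e # Cs" "map cbv us = Cs @ T # Bs"
        | "map cbv ts = As" "e = T" "map cbv us = Bs"
        | Cs where "map cbv ts = As @ T # Cs" "Bs = Cs @ e # map cbv us"
        by (auto simp: append_eq_append_conv2 append_eq_Cons_conv Cons_eq_append_conv)
      then show ?thesis
      proof cases
        case 1
        then show ?thesis using arg
            bstep.arg[of _ j' T T' f "map cbv ts @ cbv t # Cs" Bs] by (auto simp: B_def)
      next
        case 2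
        then obtain U' where "B j' (cbv t) U'" using arg e jk(1) by (auto simp: B_def)
        from this[unfolded B_def, THEN bstep.arg, of f "map cbv ts" "map cbv us"]
        show ?thesis using arg by (auto simp: B_def)
      next
        case 3
        then show ?thesis using arg
            bstep.arg[of _ j' T T' f As "Cs @ cbv t # map cbv us"] by (auto simp: B_def)
      qed
    qed
    ultimately show ?thesis
      using e by (intro disjI2 exI[of _ ?e]) (simp_all add: B_def bstep.intros)
  qed (simp_all add: B_def bstep.intros)
qed

section \<open>From level-by-level to least-level factorization\<close>

text \<open>Every unit of the level is a lambda or an operator around the contracted redex, and
  these survive in the target.\<close>

lemma vstep_level_le_size: "vstep rs k t s \<Longrightarrow> k \<le> size s"
  by (induction rule: vstep.induct) auto

text \<open>\<open>bound\<close> refers to the target of a step because \<open>s\<close> stays fixed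
  along the chain of factorizations, whereas the starting term changes.\<close>

lemma ll_factorization_level_by_level:
  assumes closed: "closed_terms K"
    and fact: "\<And>k t. t \<in> terms K \<Longrightarrow> lvl_fact (step_at K) k t"
    and persist: "\<And>j l t u t'. t \<in> terms K \<Longrightarrow> step_at K j t u \<Longrightarrow> step_at K l t t' \<Longrightarrow> j < l \<Longrightarrow>
      \<exists>u'. step_at K j t' u'"
    and bound: "\<And>k t s. step_at K k t s \<Longrightarrow> k \<le> m s"
  shows "ll_factorization K"
proof -
  let ?A = "at_lvl (step_at K)" and ?F = "from_lvl (step_at K)"
  have cl: "s \<in> terms K" if "t \<in> terms K" "step_at K k t s" for k t s
    using closed that by (auto simp: closed_terms_def)
  \<comment> \<open>The redex at level \<open>j\<close> persists, so every later step at a level of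
    at least \<open>k\<close> is internal.\<close>
  have internal: "(t, s) \<in> (internal_red K)\<^sup>*"
    if "(t, s) \<in> (?F k)\<^sup>*" "t \<in> terms K" "j < k" "step_at K j t u" for t s j k u
    using that
  proof (induction arbitrary: u rule: converse_rtrancl_induct)
    case (step t t1)
    obtain l where l: "k \<le> l" "step_at K l t t1" using step.hyps(1) by (auto simp: from_lvl_iff)
    have "j < l" using l(1) step.prems(2) by simp
    with l step.prems cl have "(t, t1) \<in> internal_red K" unfolding mem_internal_red_iff by blast
    moreover obtain u' where "step_at K j t1 u'"
      using persist[OF step.prems(1,3) l(2) \<open>j < l\<close>] by blast
    then have "(t1, s) \<in> (internal_red K)\<^sup>*"
      using step.IH cl[OF step.prems(1) l(2)] step.prems(2) by blast
    ultimately show ?case by (rule converse_rtrancl_into_rtrancl)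
  qed simp
  \<comment> \<open>Steps at \<open>k\<close> are least-level as long as nothing lies below; the
    second alternative stops at the first term with a redex below \<open>k\<close>.\<close>
  have ll: "(t, s) \<in> (ll_red K)\<^sup>* \<and> s \<in> terms K \<and> (\<forall>j<k. \<forall>u. \<not> step_at K j s u) \<or>
      (\<exists>t2 j u. (t, t2) \<in> (ll_red K)\<^sup>* \<and> (t2, s) \<in> (?A k)\<^sup>* \<and> t2 \<in> terms K \<and> j < k \<and> step_at K j t2 u)"
    if "(t, s) \<in> (?A k)\<^sup>*" "t \<in> terms K" "\<forall>j<k. \<forall>u. \<not> step_at K j t u" for t s k
    using that
  proof (induction rule: converse_rtrancl_induct)
    case (step t t1)
    have t1: "step_at K k t t1" using step.hyps(1) by (simp add: at_lvl_iff)
    then have "t1 \<in> terms K" using cl step.prems(1) by blast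
    have red: "(t, t1) \<in> ll_red K"
      using t1 \<open>t1 \<in> terms K\<close> step.prems unfolding mem_ll_red_iff by (meson not_le_imp_less)
    show ?case
    proof (cases "\<exists>j<k. \<exists>u. step_at K j t1 u")
      case True
      then show ?thesis
        using red \<open>t1 \<in> terms K\<close> step.hyps(2) by (intro disjI2) blast
    next
      case False
      then have "\<forall>j<k. \<forall>u. \<not> step_at K j t1 u" by blast
      from step.IH[OF \<open>t1 \<in> terms K\<close> this] show ?thesis
      proof
        assume "(t1, s) \<in> (ll_red K)\<^sup>* \<and> s \<in> terms K \<and> (\<forall>j<k. \<forall>u. \<not> step_at K j s u)"
        with red show ?thesis by (auto intro: converse_rtrancl_into_rtrancl)
      next
        assume "\<exists>t2 j u. (t1, t2) \<in> (ll_red K)\<^sup>* \<and> (t2, s) \<in> (?A k)\<^sup>* \<and> t2 \<in> terms K \<and>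
          j < k \<and> step_at K j t2 u"
        then obtain t2 j u where "(t1, t2) \<in> (ll_red K)\<^sup>*" and t2: "(t2, s) \<in> (?A k)\<^sup>*"
          "t2 \<in> terms K" "j < k" "step_at K j t2 u" by blast
        then have "(t, t2) \<in> (ll_red K)\<^sup>*" using red by (blast intro: converse_rtrancl_into_rtrancl)
        with t2 show ?thesis by blast
      qed
    qed
  qed blast
  have main: "(t, s) \<in> (ll_red K)\<^sup>* O (internal_red K)\<^sup>*"
    if "(t, s) \<in> (?F k)\<^sup>*" "t \<in> terms K" "\<forall>j<k. \<forall>u. \<not> step_at K j t u" for t s k
    using that
  proof (induction "Suc (m s) - k" arbitrary: k t rule: less_induct)
    case less
    show ?case
    proof (cases "m s < k")
      case True
      \<comment> \<open>A last step into \<open>s\<close> would have a level of at least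
        \<open>k\<close>, beyond the bound \<open>m s\<close>.\<close>
      have "t = s"
        using less.prems(1)
      proof (cases rule: rtrancl.cases)
        case (rtrancl_into_rtrancl b)
        then obtain l where "k \<le> l" "step_at K l b s" by (auto simp: from_lvl_iff)
        then show ?thesis using bound True by fastforce
      qed simp
      then show ?thesis by blast
    next
      case False
      obtain t1 where t1: "(t, t1) \<in> (?A k)\<^sup>*" "(t1, s) \<in> (?F (Suc k))\<^sup>*"
        using fact[OF less.prems(2), of k] less.prems(1) by (auto simp: lvl_fact_def)
      from ll[OF t1(1) less.prems(2,3)] show ?thesis
      proof (elim disjE exE conjE)
        assume *: "(t, t1) \<in> (ll_red K)\<^sup>*" "t1 \<in> terms K" "\<forall>j<k. \<forall>u. \<not> step_at K j t1 u"
        have "(t1, s) \<in> (ll_red K)\<^sup>* O (internal_red K)\<^sup>*"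
        \<comment> \<open>A remaining redex at \<open>k\<close> makes the rest internal; if level
          \<open>k\<close> is exhausted, the chain continues at \<open>Suc k\<close>.\<close>
        proof (cases "\<exists>u. step_at K k t1 u")
          case True
          then show ?thesis using internal[OF t1(2) *(2), of k] by blast
        next
          case None: False
          have "Suc (m s) - Suc k < Suc (m s) - k" using False by simp
          then show ?thesis
            using less.hyps[of "Suc k" t1] t1(2) *(2,3) None by (auto simp: less_Suc_eq)
        qed
        with *(1) show ?thesis by (blast intro: rtrancl_trans)
      next
        fix t2 j u
        assume *: "(t, t2) \<in> (ll_red K)\<^sup>*" "(t2, t1) \<in> (?A k)\<^sup>*" "t2 \<in> terms K" "j < k" "step_at K j t2 u"
        \<comment> \<open>After the early stop at \<open>t2\<close>, the remaining steps at
          \<open>k\<close> and all deeper ones are internal.\<close>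
        have "?A k \<subseteq> ?F k" "?F (Suc k) \<subseteq> ?F k"
          by (auto simp: at_lvl_iff from_lvl_iff) (meson Suc_leD)
        then have "(t2, s) \<in> (?F k)\<^sup>*"
          using *(2) t1(2) by (meson rtrancl_mono rtrancl_trans subsetD)
        from internal[OF this *(3,4,5)] show ?thesis using *(1) by blast
      qed
    qed
  qed
  show ?thesis
    unfolding ll_factorization_def
  proof (intro subrelI)
    fix t s
    assume ts: "(t, s) \<in> (red K)\<^sup>*"
    show "(t, s) \<in> (ll_red K)\<^sup>* O (internal_red K)\<^sup>*"
    proof (cases "t \<in> terms K")
      case True
      have "red K \<subseteq> ?F 0" by (auto simp: mem_red_iff from_lvl_iff)
      then have "(t, s) \<in> (?F 0)\<^sup>*" using ts rtrancl_mono by blast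
      then show ?thesis using main[of t s 0] True by simp
    next
      case False
      then have "t = s" using ts by (auto elim: converse_rtranclE simp: mem_red_iff)
      then show ?thesis by blast
    qed
  qed
qed


section \<open>Normalization for call-by-value\<close>

text \<open>The translation sends a least-level step to one or two least-level steps and, by
  \<open>bstep_cbvD\<close>, normal terms to normal terms. A counterexample for \<open>K\<close>
  thus gives one for \<open>K'\<close>.\<close>

lemma cbv_ll_normalization:
  assumes rs: "Domain rs \<subseteq> range (case_prod Op)"
    and closed: "closed_terms K" "closed_terms K'"
    and terms: "terms K = lam_terms Ops ar" "terms K' = bang_terms Ops ar"
    and steps: "step_at K = vstep rs" "step_at K' = bstep (image_pairs cbv rs)"
    and norm: "ll_normalization K'"
  shows "ll_normalization K"
proof -
  let ?B = "bstep (image_pairs cbv rs)"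
  have cl: "S \<in> terms K'" if "T \<in> terms K'" "?B k T S" for k T S
    using closed(2) that by (auto simp: closed_terms_def steps)
  have cbv_terms: "cbv t \<in> terms K'" if "t \<in> terms K" for t
    using that cbv_bang_terms by (auto simp: terms)
  have mem: "(T, S) \<in> red K'" if "T \<in> terms K'" "?B k T S" for k T S
    using that cl by (auto simp: mem_red_iff steps)
  have mem_ll: "(T, S) \<in> ll_red K'"
    if "T \<in> terms K'" "?B k T S" "\<And>j U. ?B j T U \<Longrightarrow> k \<le> j" for k T S
    using that cl unfolding mem_ll_red_iff steps by blast
  have red: "(cbv t, cbv s) \<in> (red K')\<^sup>*" if ts: "(t, s) \<in> red K" for t s
  proof -
    obtain k where k: "t \<in> terms K" "vstep rs k t s" using ts by (auto simp: mem_red_iff steps)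
    from vstep_cbv[OF rs k(2)] show ?thesis
    proof (elim disjE exE conjE)
      assume "?B k (cbv t) (cbv s)"
      then show ?thesis using mem cbv_terms[OF k(1)] by blast
    next
      fix e
      assume e: "?B k (cbv t) e" "?B k e (cbv s)"
      have "(cbv t, e) \<in> red K'" using mem[OF cbv_terms[OF k(1)] e(1)] .
      moreover have "(e, cbv s) \<in> red K'" using mem[OF cl[OF cbv_terms[OF k(1)] e(1)] e(2)] .
      ultimately show ?thesis by simp
    qed
  qed
  have ll: "(cbv t, cbv s) \<in> (ll_red K')\<^sup>+" if ts: "(t, s) \<in> ll_red K" for t s
  proof -
    obtain k where k: "t \<in> terms K" "vstep rs k t s" "\<forall>j u. vstep rs j t u \<longrightarrow> k \<le> j"
      using ts by (auto simp: mem_ll_red_iff steps)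
    \<comment> \<open>Every redex of \<open>cbv t\<close> is matched by a redex of \<open>t\<close>
      at the same level.\<close>
    have least: "k \<le> j" if "?B j (cbv t) U" for j U
      using bstep_cbvD[OF that] k(3) by blast
    from vstep_cbv[OF rs k(2)] show ?thesis
    proof (elim disjE exE conjE)
      assume "?B k (cbv t) (cbv s)"
      then show ?thesis using mem_ll[OF cbv_terms[OF k(1)]] least by blast
    next
      fix e
      assume e: "?B k (cbv t) e" "?B k e (cbv s)"
        "\<forall>j U. j < k \<longrightarrow> ?B j e U \<longrightarrow> (\<exists>U'. ?B j (cbv t) U')"
      have "(cbv t, e) \<in> ll_red K'" using mem_ll[OF cbv_terms[OF k(1)] e(1) least] .
      \<comment> \<open>A redex of \<open>e\<close> below \<open>k\<close> would give one of
        \<open>cbv t\<close>, against \<open>least\<close>.\<close>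
      moreover have "k \<le> j" if U: "?B j e U" for j U
      proof (rule ccontr)
        assume "\<not> k \<le> j"
        then obtain U' where "?B j (cbv t) U'" using e(3) U by (meson not_le_imp_less)
        then show False using least \<open>\<not> k \<le> j\<close> by blast
      qed
      then have "(e, cbv s) \<in> ll_red K'" using mem_ll[OF cl[OF cbv_terms[OF k(1)] e(1)] e(2)] by blast
      ultimately show ?thesis by (rule trancl_into_trancl[OF r_into_trancl])
    qed
  qed
  show ?thesis
    unfolding ll_normalization_iff[OF closed(1)]
  proof (intro allI impI notI)
    fix t u
    assume *: "(t, u) \<in> (red K)\<^sup>* \<and> normal (red K) u" "infinite_from (ll_red K) t"
    then have "t \<in> terms K" by (metis infinite_from_def mem_ll_red_iff)
    then have "u \<in> terms K" using * by (auto elim: rtranclE simp: mem_red_iff)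
    then have "\<not> vstep rs k u s" for k s
      using * closed(1) unfolding normal_def mem_red_iff closed_terms_def steps by blast
    then have "normal (red K') (cbv u)"
      unfolding normal_def mem_red_iff steps by (blast dest: bstep_cbvD)
    moreover have "infinite_from (ll_red K') (cbv t)"
      by (rule infinite_from_simulation[OF _ *(2)]) (rule ll)
    moreover have "(cbv t, cbv u) \<in> (red K')\<^sup>*"
      using conjunct1[OF *(1)] by induction (auto dest: red intro: rtrancl_trans)
    ultimately show False
      using norm unfolding ll_normalization_iff[OF closed(2)] by blast
  qed
qed

section \<open>Assembling the transfer results\<close>

lemma Domain_image_pairs: "Domain (image_pairs tr r) = tr ` Domain r"
  by (force simp: image_pairs_def)

lemma Range_image_pairs: "Range (image_pairs tr r) = tr ` Range r"
  by (force simp: image_pairs_def)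

lemma UN_image_rules: "(\<Union>f\<in>Ops. image_rules tr \<rho> f) = image_pairs tr (\<Union>f\<in>Ops. \<rho> f)"
  by (auto simp: image_rules_def image_pairs_def)

theorem theorem1:
  fixes Ops :: "'o set" and ar :: "'o \<Rightarrow> nat" and \<rho> :: "'o \<Rightarrow> ('o lam \<times> 'o lam) set"
  assumes "operator_rules Ops ar \<rho>"
  shows
    "(ll_factorization (bang_calculus Ops ar (image_rules cbn \<rho>)) \<longrightarrow>
        ll_factorization (cbn_calculus Ops ar \<rho>)) \<and>
     (operator_redexes_stable Ops \<rho> (red (cbv_calculus Ops ar \<rho>)) \<longrightarrow>
        ll_factorization (bang_calculus Ops ar (image_rules cbv \<rho>)) \<longrightarrow>
        ll_factorization (cbv_calculus Ops ar \<rho>)) \<and>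
     (ll_normalization (bang_calculus Ops ar (image_rules cbn \<rho>)) \<longrightarrow>
        ll_normalization (cbn_calculus Ops ar \<rho>)) \<and>
     (ll_normalization (bang_calculus Ops ar (image_rules cbv \<rho>)) \<longrightarrow>
        ll_normalization (cbv_calculus Ops ar \<rho>))"
proof -
  define rs where "rs = (\<Union>f\<in>Ops. \<rho> f)"
  let ?N = "cbn_calculus Ops ar \<rho>" and ?V = "cbv_calculus Ops ar \<rho>"
  let ?BN = "bang_calculus Ops ar (image_rules cbn \<rho>)"
  let ?BV = "bang_calculus Ops ar (image_rules cbv \<rho>)"
  have "\<exists>f ts. r = Op f ts" "r' \<in> lam_terms Ops ar" if "(r, r') \<in> rs" for r r'
    using that assms unfolding rs_def operator_rules_def by fast+
  then have Op: "Domain rs \<subseteq> range (case_prod Op)" and target: "Range rs \<subseteq> lam_terms Ops ar"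
    by (fastforce simp: image_iff)+
  have imgN: "Domain (image_pairs cbn rs) \<subseteq> range (case_prod BOp)"
    "Range (image_pairs cbn rs) \<subseteq> bang_terms Ops ar"
  proof -
    have "cbn x \<in> range (case_prod BOp)" if "x \<in> Domain rs" for x
      using subsetD[OF Op that] by (auto simp: image_iff)
    then show "Domain (image_pairs cbn rs) \<subseteq> range (case_prod BOp)"
      by (auto simp: Domain_image_pairs)
    show "Range (image_pairs cbn rs) \<subseteq> bang_terms Ops ar"
      unfolding Range_image_pairs using target cbn_bang_terms by blast
  qed
  have imgV: "Domain (image_pairs cbv rs) \<subseteq> range (case_prod BOp)"
    "Range (image_pairs cbv rs) \<subseteq> bang_terms Ops ar"
  proof -
    have "cbv x \<in> range (case_prod BOp)" if "x \<in> Domain rs" for x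
      using subsetD[OF Op that] by (auto simp: image_iff)
    then show "Domain (image_pairs cbv rs) \<subseteq> range (case_prod BOp)"
      by (auto simp: Domain_image_pairs)
    show "Range (image_pairs cbv rs) \<subseteq> bang_terms Ops ar"
      unfolding Range_image_pairs using target cbv_bang_terms by blast
  qed
  have N: "terms ?N = lam_terms Ops ar" "step_at ?N = nstep rs"
    using step_at_cbn[of rs ?N] Op by (auto simp: cbn_calculus_def rs_def)
  have V: "terms ?V = lam_terms Ops ar" "step_at ?V = vstep rs"
    using step_at_cbv[of rs ?V] Op by (auto simp: cbv_calculus_def rs_def)
  have BN: "terms ?BN = bang_terms Ops ar" "step_at ?BN = bstep (image_pairs cbn rs)"
    using step_at_bang[of "image_pairs cbn rs" ?BN] imgN(1)
    by (auto simp: bang_calculus_def rs_def UN_image_rules)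
  have BV: "terms ?BV = bang_terms Ops ar" "step_at ?BV = bstep (image_pairs cbv rs)"
    using step_at_bang[of "image_pairs cbv rs" ?BV] imgV(1)
    by (auto simp: bang_calculus_def rs_def UN_image_rules)
  have closed: "closed_terms ?N" "closed_terms ?V" "closed_terms ?BN" "closed_terms ?BV"
    unfolding closed_terms_def N V BN BV
    using nstep_lam_terms[OF target] vstep_lam_terms[OF target]
      bstep_bang_terms[OF imgN(2)] bstep_bang_terms[OF imgV(2)] by blast+
  have simN: "step_at ?BN k (cbn t) (cbn s)" if "step_at ?N k t s" for k t s
    using nstep_cbn that unfolding N BN by blast
  have reflN: "\<exists>s. S = cbn s \<and> step_at ?N k t s" if "step_at ?BN k (cbn t) S" for k t S
    using bstep_cbnD[OF Op] that unfolding N BN by blast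
  have termsN: "cbn t \<in> terms ?BN" if "t \<in> terms ?N" for t
    using that cbn_bang_terms unfolding N BN by blast
  have "inj cbn" by (simp add: inj_on_def inj_cbn)
  note transferN = transfer_by_bisimulation[OF closed(1,3) termsN this simN reflN]
  have factV: "ll_factorization ?V"
    if stable: "operator_redexes_stable Ops \<rho> (red ?V)" and fact: "ll_factorization ?BV"
  proof (rule ll_factorization_level_by_level[OF closed(2)])
    fix k t assume t: "t \<in> terms ?V"
    show "lvl_fact (step_at ?V) k t"
      unfolding V(2)
    proof (rule lvl_fact_cbv)
      have "cbv t \<in> bang_terms Ops ar" using t cbv_bang_terms unfolding V by blast
      then show "lvl_fact (bstep (image_pairs cbv rs)) k (cbv t)"
        using lvl_fact_bang[of Ops ar "image_pairs cbv rs"]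
          surface_factorization[OF fact BV imgV(2)] by blast
    next
      fix l t s assume "vstep rs l t s"
      \<comment> \<open>One or two bang steps, all at level \<open>l\<close>.\<close>
      from vstep_cbv[OF Op this]
      show "(cbv t, cbv s) \<in> (at_lvl (bstep (image_pairs cbv rs)) l)\<^sup>*"
        unfolding at_lvl_iff[symmetric] by (meson r_into_rtrancl rtrancl_into_rtrancl)
    qed
  next
    have "Op f (ts @ a' # us) \<in> Domain rs"
      if dom: "Op f (ts @ a # us) \<in> Domain rs" and a: "a \<in> lam_terms Ops ar" "vstep rs l a a'" for f ts a l a' us
    proof -
      obtain g r' where g: "g \<in> Ops" "(Op f (ts @ a # us), r') \<in> \<rho> g" using dom by (auto simp: rs_def)
      \<comment> \<open>Left-hand sides in \<open>\<rho> g\<close> are headed by \<open>g\<close>,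
        so a redex found in the union belongs to the operator at its head.\<close>
      then have "f = g" using assms by (fastforce simp: operator_rules_def)
      have "(a, a') \<in> red ?V"
        using a vstep_lam_terms[OF target a(2,1)] by (auto simp: mem_red_iff V)
      then have "Op f (ts @ a' # us) \<in> Domain (\<rho> g)"
        using stable g \<open>f = g\<close> unfolding operator_redexes_stable_def by blast
      then show ?thesis using g(1) by (auto simp: rs_def)
    qed
    then have persist: "\<exists>u'. vstep rs j t' u'"
      if "vstep rs j t u" "vstep rs l t t'" "j < l" "t \<in> lam_terms Ops ar" for j l t u t'
      using that by (rule vstep_persist)
    show "\<exists>u'. step_at ?V j t' u'"
      if "t \<in> terms ?V" "step_at ?V j t u" "step_at ?V l t t'" "j < l" for j l t u t'
      using that(2,3,4,1) unfolding V by (rule persist)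
  next
    show "k \<le> size s" if "step_at ?V k t s" for k t s
      using vstep_level_le_size that unfolding V by blast
  qed
  show ?thesis
    using transferN factV cbv_ll_normalization[OF Op closed(2,4) V(1) BV(1) V(2) BV(2)] by blast
qed

end
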